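(* Let $n_1,\ldots,n_N\in S^2$, let $c_1,\ldots,c_N>0$, and put $$\mu=\frac12\sum_{p=1}^Nc_p\left(\delta_{n_p}+\delta_{-n_p}\right),\qquad M=\sum_{p=1}^Nc_pn_pn_p^T,\qquad s=\sum_{p=1}^Nc_p.$$ For every even $l$, $$\sum_{m=-l}^{l}\left|\hat\mu_{lm}\right|^2=(2l+1)\sum_{p,q=1}^Nc_pc_qP_l(n_p\cdot n_q).$$ At degree two, $$\sum_{p,q=1}^Nc_pc_qP_2(n_p\cdot n_q)=\frac12\left(3\|M\|_F^2-s^2\right)=\frac32\left\|M-\frac s3I\right\|_F^2.$$ Consequently, the degree-two contribution $a_2^2\sum_{m=-2}^{2}|\hat\mu_{2m}|^2$ to the variance $$\operatorname{Var}\left(\int_{S^2}|U\cdot n|\,d\mu(n)\right)=\sum_{j\ge1}a_{2j}^2\sum_{m=-2j}^{2j}|\hat\mu_{2j,m}|^2$$ is $$\frac{15}{128}\left\|M-\frac s3I\right\|_F^2.$$ It vanishes if and only if the weighted directions form a unit-norm tight frame: $M=\frac s3I$.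
   Context: $P_l$ is the Legendre polynomial of degree $l$, $\|\cdot\|_F$ the Frobenius norm, $I$ the $3\times3$ identity. $U$ is uniformly distributed on $S^2$ with respect to the rotation-invariant probability measure $\sigma$; $(Y_{lm})$ are spherical harmonics orthonormal in $L^2(S^2,\sigma)$ and $\hat\mu_{lm}=\int_{S^2}\overline{Y_{lm}(n)}\,d\mu(n)$. $a_l=\frac12\int_{-1}^1|t|P_l(t)\,dt$, so $a_2=\frac18$. *)

theory Defs
  imports "HOL-Probability.Probability" "HOL-Computational_Algebra.Polynomial"
begin

text \<open>Rodrigues' formula for the Legendre polynomials.\<close>

definition legendre :: "nat \<Rightarrow> real poly" where
  "legendre l = smult (1 / (2 ^ l * fact l)) ((pderiv ^^ l) ([:-1, 0, 1:] ^ l))"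

definition abs_legendre_coeff :: "nat \<Rightarrow> real" where
  "abs_legendre_coeff l = 1 / 2 * integral {-1..1} (\<lambda>t. \<bar>t\<bar> * poly (legendre l) t)"

text \<open>The unit sphere of three-space with its Borel sets; only the underlying sigma-algebra
  of this measure space is used.\<close>

definition sphere_borel :: "(real^3) measure" where
  "sphere_borel = restrict_space borel (sphere 0 1)"

text \<open>This determines the measure uniquely. Invariance is asked under proper rotations only.\<close>

definition uniform_sphere_measure :: "(real^3) measure \<Rightarrow> bool" where
  "uniform_sphere_measure \<sigma> \<longleftrightarrow>
     sets \<sigma> = sets sphere_borel \<and> prob_space \<sigma> \<and>
     (\<forall>Q :: real^3^3. rotation_matrix Q \<longrightarrow> distr \<sigma> \<sigma> ((*v) Q) = \<sigma>)"

text \<open>Sum of the second partial derivatives; it is only applied to polynomial functions,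
  for which all the derivatives exist.\<close>

definition laplacian :: "(real^3 \<Rightarrow> complex) \<Rightarrow> real^3 \<Rightarrow> complex" where
  "laplacian f x =
     (\<Sum>i\<in>UNIV. vector_derivative
        (\<lambda>t. vector_derivative (\<lambda>u. f (x + u *\<^sub>R axis i 1)) (at t)) (at 0))"

text \<open>A spherical harmonic of degree \<open>l\<close> is the restriction to the sphere of a harmonic
  polynomial, homogeneous of degree \<open>l\<close>. Values off the sphere are irrelevant.\<close>

definition spherical_harmonic :: "nat \<Rightarrow> (real^3 \<Rightarrow> complex) \<Rightarrow> bool" where
  "spherical_harmonic l f \<longleftrightarrow>
     (\<exists>h. polynomial_function h \<and>
          (\<forall>r x. h (r *\<^sub>R x) = of_real (r ^ l) * h x) \<and>
          (\<forall>x. laplacian h x = 0) \<and>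
          (\<forall>x\<in>sphere 0 1. f x = h x))"

text \<open>Any choice of orthonormal harmonics is admitted: for each \<open>l\<close> there are \<open>2 * l + 1\<close> of
  them, indexed by \<open>m\<close> from \<open>- l\<close> to \<open>l\<close>.\<close>

definition orthonormal_spherical_harmonics ::
    "(real^3) measure \<Rightarrow> (nat \<Rightarrow> int \<Rightarrow> real^3 \<Rightarrow> complex) \<Rightarrow> bool" where
  "orthonormal_spherical_harmonics \<sigma> Y \<longleftrightarrow>
     (\<forall>l. \<forall>m\<in>{- int l..int l}. spherical_harmonic l (Y l m)) \<and>
     (\<forall>l l'. \<forall>m\<in>{- int l..int l}. \<forall>m'\<in>{- int l'..int l'}.
        (\<integral>x. Y l m x * cnj (Y l' m' x) \<partial>\<sigma>) = (if l = l' \<and> m = m' then 1 else 0))"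

definition harmonic_coeff ::
    "(nat \<Rightarrow> int \<Rightarrow> real^3 \<Rightarrow> complex) \<Rightarrow> (real^3) measure \<Rightarrow> nat \<Rightarrow> int \<Rightarrow> complex" where
  "harmonic_coeff Y \<mu> l m = (\<integral>x. cnj (Y l m x) \<partial>\<mu>)"

text \<open>The weighted sum of Dirac measures at the points \<open>n p\<close> and their antipodes, each pair
  \<open>p\<close> carrying total mass \<open>c p\<close>.\<close>

definition symmetrized_measure ::
    "nat \<Rightarrow> (nat \<Rightarrow> real) \<Rightarrow> (nat \<Rightarrow> real^3) \<Rightarrow> (real^3) measure" where
  "symmetrized_measure N c n =
     measure_of (space sphere_borel) (sets sphere_borel)
       (\<lambda>A. ennreal (1 / 2) * (\<Sum>p=1..N. ennreal (c p) *
          (emeasure (return sphere_borel (n p)) A + emeasure (return sphere_borel (- n p)) A)))"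

lemma space_sphere_borel: "space sphere_borel = sphere 0 1"
  by (simp add: sphere_borel_def space_restrict_space)

lemma sets_symmetrized_measure [simp, measurable_cong]:
  "sets (symmetrized_measure N c n) = sets sphere_borel"
  by (simp add: symmetrized_measure_def)

lemma space_symmetrized_measure [simp]:
  "space (symmetrized_measure N c n) = sphere 0 1"
  by (simp only: symmetrized_measure_def space_measure_of_conv space_sphere_borel)

lemma emeasure_symmetrized_measure:
  assumes "A \<in> sets sphere_borel"
  shows "emeasure (symmetrized_measure N c n) A =
    ennreal (1 / 2) * (\<Sum>p=1..N. ennreal (c p) * (indicator A (n p) + indicator A (- n p)))"
proof -
  let ?f = "\<lambda>A. ennreal (1 / 2) * (\<Sum>p=1..N. ennreal (c p) *
    (emeasure (return sphere_borel (n p)) A + emeasure (return sphere_borel (- n p)) A))"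
  have "countably_additive (sets sphere_borel) ?f"
  proof (rule countably_additiveI)
    fix B :: "nat \<Rightarrow> (real^3) set"
    assume B: "range B \<subseteq> sets sphere_borel" "disjoint_family B"
    have "(\<Sum>i. emeasure (return sphere_borel x) (B i)) =
        emeasure (return sphere_borel x) (\<Union>i. B i)" for x
      using B by (intro suminf_emeasure) auto
    then show "(\<Sum>i. ?f (B i)) = ?f (\<Union>i. B i)"
      by (simp add: suminf_sum suminf_add [symmetric])
  qed
  then have "emeasure (symmetrized_measure N c n) A = ?f A"
    unfolding symmetrized_measure_def using assms
    by (intro emeasure_measure_of_sigma) (auto simp: positive_def sets.sigma_algebra_axioms)
  then show ?thesis
    using assms by simp
qed

definition outer_product :: "real^'n \<Rightarrow> real^'m \<Rightarrow> real^'m^'n" where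
  "outer_product u v = (\<chi> i j. u $ i * v $ j)"

text \<open>The norm of a matrix, as a vector of rows, is the Euclidean norm of the norms of its rows.\<close>

abbreviation frobenius_norm :: "real^'n^'m \<Rightarrow> real" where
  "frobenius_norm A \<equiv> norm A"

lemma frobenius_norm_eq: "frobenius_norm A = sqrt (\<Sum>i\<in>UNIV. \<Sum>j\<in>UNIV. (A $ i $ j)\<^sup>2)"
  by (simp add: norm_vec_def L2_set_def sum_nonneg)

text \<open>Unit vectors \<open>n p\<close> such that the scaled vectors \<open>sqrt (c p) *\<^sub>R n p\<close> form a tight frame.\<close>

definition weighted_unit_norm_tight_frame ::
    "nat \<Rightarrow> (nat \<Rightarrow> real) \<Rightarrow> (nat \<Rightarrow> real^3) \<Rightarrow> bool" where
  "weighted_unit_norm_tight_frame N c n \<longleftrightarrow>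
     (\<forall>p\<in>{1..N}. norm (n p) = 1) \<and>
     (\<exists>A>0. \<forall>x. (\<Sum>p=1..N. c p * (n p \<bullet> x)\<^sup>2) = A * (norm x)\<^sup>2)"

end

theory Submission
  imports Defs
begin

text \<open>Rotation invariance of \<open>\<sigma>\<close> makes the rotation generators
  \<open>y\<^sub>i \<partial>\<^sub>j - y\<^sub>j \<partial>\<^sub>i\<close> integrate to zero, so the sum of their squares, the spherical Laplacian,
  is symmetric. Comparing eigenvalues, an eigenfunction \<open>f\<close> of degree \<open>l\<close> satisfies
  \<open>\<integral> P\<^sub>j (x \<bullet> y) f y = 0\<close> for \<open>j \<noteq> l\<close>; testing against polynomials in \<open>x \<bullet> y\<close> that concentrate
  at \<open>x\<close> fixes the remaining constant and yields the Funk--Hecke formula.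

  With \<open>K(x, y) = (2l + 1) P\<^sub>l (x \<bullet> y) - (\<Sum>m. Y\<^sub>l\<^sub>m x * cnj (Y\<^sub>l\<^sub>m y))\<close>, the Funk--Hecke formula gives
  \<open>\<integral> \<bar>K(x, y)\<bar>\<^sup>2 dy = 2l + 1 - (\<Sum>m. \<bar>Y\<^sub>l\<^sub>m x\<bar>\<^sup>2)\<close>. This is nonnegative with integral zero over \<open>x\<close>,
  so \<open>K = 0\<close>: the addition theorem, obtained without computing the dimension of the space of harmonics.

  The variance series is Parseval's identity for \<open>u \<mapsto> \<Sum>p. c\<^sub>p \<bar>n\<^sub>p \<bullet> u\<bar>\<close>; completeness comes from
  approximating \<open>\<bar>t\<bar>\<close> uniformly by polynomials.\<close>

section \<open>Legendre polynomials\<close>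

text \<open>Each of the \<open>k\<close> derivatives must consume one factor \<open>X - a\<close> to
  survive at \<open>a\<close>. Differentiating once leaves one factor fewer, times a polynomial
  whose value at \<open>a\<close> is \<open>Suc k\<close> times that of \<open>q\<close>; hence the
  induction with \<open>q\<close> arbitrary.\<close>

lemma higher_pderiv_zero_order:
  fixes q :: "real poly"
  shows "poly ((pderiv ^^ k) ([:-a, 1:] ^ k * q)) a = fact k * poly q a"
proof (induction k arbitrary: q)
  case (Suc k)
  have "pderiv ([:-a, 1:] ^ Suc k * q) = [:-a, 1:] ^ k * (smult (of_nat (Suc k)) q + [:-a, 1:] * pderiv q)"
    unfolding pderiv_mult pderiv_power_Suc
    by (simp add: pderiv_pCons algebra_simps smult_add_right)
  then show ?case
    using Suc by (simp add: funpow_Suc_right del: funpow.simps)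
qed simp

text \<open>Split off \<open>(X - 1) ^ l\<close>: the cofactor \<open>(X + 1) ^ l\<close> has value
  \<open>2 ^ l\<close> at 1, and with \<open>fact l\<close> it cancels the normalisation in
  Rodrigues' formula.\<close>

lemma poly_legendre_1: "poly (legendre l) 1 = 1"
proof -
  have e: "[:-1, 0, 1:] = [:-1, 1:] * [:1, 1::real:]"
    by simp
  have "poly ((pderiv ^^ l) ([:-1, 1:] ^ l * [:1, 1:] ^ l)) (1::real) = fact l * 2 ^ l"
    using higher_pderiv_zero_order[where a = "1::real"] by (simp add: poly_power)
  then show ?thesis
    unfolding legendre_def e power_mult_distrib by simp
qed

lemma poly_legendre_neg_1: "poly (legendre l) (- 1) = (- 1) ^ l"
proof -
  have e: "[:-1, 0, 1:] = [:1, 1:] * [:-1, 1::real:]"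
    by simp
  have "poly ((pderiv ^^ l) ([:1, 1:] ^ l * [:-1, 1:] ^ l)) (-1::real) = fact l * (-2) ^ l"
    using higher_pderiv_zero_order[where a = "-1::real"] by (simp add: poly_power)
  moreover have "(-2::real) ^ l = (-1) ^ l * 2 ^ l"
    by (simp flip: power_mult_distrib)
  ultimately show ?thesis
    unfolding legendre_def e power_mult_distrib by simp
qed

lemma degree_legendre: "degree (legendre l) = l"
proof -
  have *: "degree ((pderiv ^^ k) p) = degree p - k" for k and p :: "real poly"
    by (induction k) (auto simp: degree_pderiv)
  have "degree ([:-1, 0, 1:] ^ l :: real poly) = 2 * l"
    by (simp add: degree_power_eq)
  then show ?thesis
    by (simp add: legendre_def *)
qed

text \<open>Leibniz' rule for a product with \<open>X\<close>; only two terms remain because the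
  second derivative of \<open>X\<close> is zero.\<close>

lemma higher_pderiv_X_mult:
  "(pderiv ^^ Suc k) ([:0, 1:] * p) =
     [:0, 1:] * (pderiv ^^ Suc k) p + smult (of_nat (Suc k)) ((pderiv ^^ k) p)"
  for p :: "real poly"
  by (induction k) (simp_all add: pderiv_mult pderiv_add pderiv_smult pderiv_pCons algebra_simps smult_add_left numeral_poly)

text \<open>The power \<open>w = (X^2 - 1)^l\<close> satisfies the first-order equation
  \<open>(X^2 - 1) w' = 2 l X w\<close>. Differentiating it \<open>l + 1\<close> times gives the
  equation for the \<open>l\<close>-th derivative of \<open>w\<close>, a multiple of the Legendre
  polynomial.\<close>

lemma legendre_ode:
  "(1 - t\<^sup>2) * poly (pderiv (pderiv (legendre l))) t - 2 * t * poly (pderiv (legendre l)) t =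
     - (real l * (real l + 1)) * poly (legendre l) t"
proof (cases l)
  case 0
  then show ?thesis by (simp add: legendre_def)
next
  case (Suc k)
  define w :: "real poly" where "w = [:-1, 0, 1:] ^ l"
  let ?X = "[:0, 1::real:]"
  let ?D = "\<lambda>k. (pderiv ^^ k) w"
  have diff: "(pderiv ^^ k) (p - q) = (pderiv ^^ k) p - (pderiv ^^ k) q" for k and p q :: "real poly"
    by (induction k) (simp_all add: pderiv_diff)
  have smult: "(pderiv ^^ k) (smult a p) = smult a ((pderiv ^^ k) p)" for k a and p :: "real poly"
    by (induction k) (simp_all add: pderiv_smult)
  have "pderiv w = smult (real l) ([:-1, 0, 1:] ^ k * [:0, 2:])"
    unfolding w_def Suc pderiv_power_Suc by (simp add: pderiv_pCons algebra_simps)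
  then have "[:-1, 0, 1:] * pderiv w = smult (2 * real l) (?X * w)"
    unfolding w_def Suc by (simp add: algebra_simps)
  \<comment> \<open>Writing \<open>X^2 - 1\<close> through two multiplications by \<open>X\<close>
    makes the Leibniz rule above applicable twice.\<close>
  then have "?X * (?X * pderiv w) - pderiv w = smult (2 * real l) (?X * w)"
    by (simp add: algebra_simps)
  then have eq: "(pderiv ^^ Suc l) (?X * (?X * pderiv w) - pderiv w) = (pderiv ^^ Suc l) (smult (2 * real l) (?X * w))"
    by simp
  \<comment> \<open>The rule is stated for orders of the form \<open>Suc k\<close>; in the term
    where only \<open>l\<close> derivatives remain, \<open>l = Suc k\<close> has to be exposed
    before the inner \<open>X\<close> can be treated.\<close>
  have lhs: "(pderiv ^^ Suc l) (?X * (?X * pderiv w) - pderiv w) =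
      ?X * (?X * ?D (Suc (Suc l)) + smult (real (Suc l)) (?D (Suc l))) +
      smult (real (Suc l)) (?X * ?D (Suc l) + smult (real l) (?D l)) - ?D (Suc (Suc l))"
    unfolding diff higher_pderiv_X_mult
    unfolding Suc higher_pderiv_X_mult
    by (simp only: funpow_Suc_right o_def)
  have rhs: "(pderiv ^^ Suc l) (smult (2 * real l) (?X * w)) =
      smult (2 * real l) (?X * ?D (Suc l) + smult (real (Suc l)) (?D l))"
    unfolding smult higher_pderiv_X_mult ..
  define c where "c = 1 / (2 ^ l * fact l :: real)"
  have P: "legendre l = smult c (?D l)" "pderiv (legendre l) = smult c (?D (Suc l))"
     "pderiv (pderiv (legendre l)) = smult c (?D (Suc (Suc l)))"
    by (simp_all add: legendre_def w_def c_def pderiv_smult)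
  have e: "t * (t * poly (?D (Suc (Suc l))) t + (real l + 1) * poly (?D (Suc l)) t) +
      (real l + 1) * (t * poly (?D (Suc l)) t + real l * poly (?D l) t) - poly (?D (Suc (Suc l))) t =
      2 * real l * (t * poly (?D (Suc l)) t + (real l + 1) * poly (?D l) t)"
    using arg_cong[OF eq, of "\<lambda>p. poly p t"] unfolding lhs rhs by (simp add: add.commute del: funpow.simps)
  have "(1 - t\<^sup>2) * poly (?D (Suc (Suc l))) t - 2 * t * poly (?D (Suc l)) t =
      - (real l * (real l + 1)) * poly (?D l) t"
    using e by algebra
  then have "c * ((1 - t\<^sup>2) * poly (?D (Suc (Suc l))) t - 2 * t * poly (?D (Suc l)) t) =
      c * (- (real l * (real l + 1)) * poly (?D l) t)"
    by simp
  then show ?thesis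
    unfolding P(3) unfolding P(2) unfolding P(1) by (simp add: algebra_simps del: funpow.simps)
qed

section \<open>Orthogonality, expansions and norms of Legendre polynomials\<close>

lemma integral_pderiv:
  "((\<lambda>t. poly (pderiv p) t) has_integral poly p 1 - poly p (- 1 :: real)) {-1..1}"
  by (rule fundamental_theorem_of_calculus)
     (auto intro: DERIV_subset poly_DERIV simp flip: has_real_derivative_iff_has_vector_derivative)

text \<open>A Sturm-Liouville argument: by the differential equation, the derivative of
  \<open>W = (1 - t^2)(J' L - J L')\<close> is the difference of the eigenvalues times
  \<open>J L\<close>, while \<open>W\<close> vanishes at both endpoints.\<close>

lemma legendre_orthogonal:
  assumes "j \<noteq> l"
  shows "integral {-1..1} (\<lambda>t. poly (legendre j) t * poly (legendre l) t) = 0"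
proof -
  let ?J = "legendre j" and ?L = "legendre l"
  let ?c = "real l * (real l + 1) - real j * (real j + 1)"
  define W where "W = [:1, 0, -1:] * (pderiv ?J * ?L - ?J * pderiv ?L)"
  have "poly (pderiv W) t = ?c * (poly ?J t * poly ?L t)" for t
  proof -
    have "poly (pderiv W) t =
        poly ?L t * ((1 - t\<^sup>2) * poly (pderiv (pderiv ?J)) t - 2 * t * poly (pderiv ?J) t) -
        poly ?J t * ((1 - t\<^sup>2) * poly (pderiv (pderiv ?L)) t - 2 * t * poly (pderiv ?L) t)"
      unfolding W_def pderiv_mult pderiv_diff poly_add poly_mult poly_diff
      by (simp add: pderiv_pCons algebra_simps power2_eq_square)
    then show ?thesis
      unfolding legendre_ode by (simp add: algebra_simps)
  qed
  then have "((\<lambda>t. ?c * (poly ?J t * poly ?L t)) has_integral 0) {-1..1}"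
    using integral_pderiv[of W] by (simp add: W_def)
  moreover have "?c \<noteq> 0"
  proof -
    have "?c = (real l - real j) * (real l + real j + 1)"
      by (simp add: algebra_simps)
    then show ?thesis using assms by simp
  qed
  ultimately have "((\<lambda>t. poly ?J t * poly ?L t) has_integral 0) {-1..1}"
    using has_integral_mult_right[of "\<lambda>t. ?c * (poly ?J t * poly ?L t)" 0 "{-1..1}" "1 / ?c"]
    by simp
  then show ?thesis by (rule integral_unique)
qed

text \<open>\<open>legendre k\<close> has exact degree \<open>k\<close>, so subtracting a suitable
  multiple of it removes the coefficient of degree \<open>k\<close> and the induction hypothesis
  applies to the rest.\<close>

lemma poly_legendre_expansion:
  fixes p :: "real poly"
  assumes "degree p < k"
  shows "\<exists>b. p = (\<Sum>l<k. smult (b l) (legendre l))"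
  using assms
proof (induction k arbitrary: p)
  case (Suc k)
  have lc: "coeff (legendre k) k \<noteq> 0"
    using degree_legendre[of k] poly_legendre_1[of k] by (metis leading_coeff_0_iff poly_0 zero_neq_one)
  define b where "b = coeff p k / coeff (legendre k) k"
  define q where "q = p - smult b (legendre k)"
  show ?case
  \<comment> \<open>For \<open>k = 0\<close> the remainder would be the zero polynomial, whose
    degree 0 is not below 0, so constants are treated separately.\<close>
  proof (cases "k = 0")
    case True
    then obtain a where "p = [:a:]" using Suc.prems degree_eq_zeroE by auto
    then show ?thesis using True by (intro exI[of _ "\<lambda>_. a"]) (simp add: legendre_def)
  next
    case False
    have "degree q \<le> k"
      unfolding q_def using Suc.prems
      by (intro degree_diff_le order.trans[OF degree_smult_le]) (simp_all add: degree_legendre)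
    moreover have "coeff q k = 0"
      using lc by (simp add: q_def b_def)
    ultimately have "degree q < k"
      using False by (metis le_neq_implies_less leading_coeff_0_iff degree_0 neq0_conv)
    then obtain a where "q = (\<Sum>l<k. smult (a l) (legendre l))"
      using Suc.IH by blast
    then have "p = (\<Sum>l<Suc k. smult ((a(k := b)) l) (legendre l))"
      by (simp add: q_def algebra_simps)
    then show ?thesis by blast
  qed
qed simp

lemma legendre_orthogonal_lower_degree:
  assumes "degree p < l"
  shows "integral {-1..1} (\<lambda>t. poly p t * poly (legendre l) t) = 0"
proof -
  obtain b where p: "p = (\<Sum>j<l. smult (b j) (legendre j))"
    using poly_legendre_expansion[OF assms] by blast
  have i: "(\<lambda>t. poly p t * poly q t) integrable_on {-1..1}" for p q :: "real poly"
    by (intro integrable_continuous_interval continuous_intros)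
  have "integral {-1..1} (\<lambda>t. poly p t * poly (legendre l) t) =
      (\<Sum>j<l. integral {-1..1} (\<lambda>t. b j * (poly (legendre j) t * poly (legendre l) t)))"
    unfolding p by (subst integral_sum [symmetric])
      (auto intro!: integrable_on_mult_right i simp: poly_sum sum_distrib_right mult.assoc)
  then show ?thesis
    by (simp add: legendre_orthogonal)
qed

text \<open>Since \<open>t P' - l P\<close> has degree below \<open>l\<close>, integrating \<open>(t P\<^sup>2)'\<close> gives the norm of
  \<open>P\<close> from its values at the endpoints.\<close>

lemma legendre_norm:
  "integral {-1..1} (\<lambda>t. poly (legendre l) t * poly (legendre l) t) = 2 / (2 * real l + 1)"
proof -
  let ?P = "legendre l"
  let ?I = "integral {-1..1} (\<lambda>t. poly ?P t * poly ?P t)"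
  define r where "r = [:0, 1:] * pderiv ?P - smult (real l) ?P"
  have i: "(\<lambda>t. poly p t * poly q t) integrable_on {-1..1}" for p q :: "real poly"
    by (intro integrable_continuous_interval continuous_intros)
  have r0: "integral {-1..1} (\<lambda>t. poly r t * poly ?P t) = 0"
  proof (cases "l = 0")
    case True
    then show ?thesis by (simp add: r_def legendre_def)
  next
    case False
    have "degree r \<le> l"
      unfolding r_def
      by (intro degree_diff_le order.trans[OF degree_smult_le] order.trans[OF degree_mult_le])
         (use False in \<open>auto simp: degree_legendre degree_pderiv\<close>)
    moreover have "coeff r l = 0"
      using False by (cases l) (simp_all add: r_def coeff_pderiv)
    ultimately have "degree r < l"
      using False by (metis le_neq_implies_less leading_coeff_0_iff degree_0 neq0_conv)
    then show ?thesis by (rule legendre_orthogonal_lower_degree)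
  qed
  have e: "poly (pderiv ([:0, 1:] * ?P * ?P)) t =
      (2 * real l + 1) * (poly ?P t * poly ?P t) + 2 * (poly r t * poly ?P t)" for t
    by (simp add: r_def pderiv_mult pderiv_pCons algebra_simps)
  \<comment> \<open>The sign of the value at -1 is squared away, so the two endpoints contribute 1
    each.\<close>
  have "poly ([:0, 1:] * ?P * ?P) 1 - poly ([:0, 1:] * ?P * ?P) (- 1) = 2"
    by (simp add: poly_legendre_1 poly_legendre_neg_1 flip: power_add mult_2)
  then have "((\<lambda>t. (2 * real l + 1) * (poly ?P t * poly ?P t) + 2 * (poly r t * poly ?P t)) has_integral 2) {-1..1}"
    using integral_pderiv[of "[:0, 1:] * ?P * ?P"] unfolding e by metis
  moreover have "((\<lambda>t. (2 * real l + 1) * (poly ?P t * poly ?P t) + 2 * (poly r t * poly ?P t)) has_integral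
      (2 * real l + 1) * ?I + 2 * 0) {-1..1}"
    unfolding r0[symmetric] by (intro has_integral_add has_integral_mult_right integrable_integral i)
  ultimately have "2 = (2 * real l + 1) * ?I + 2 * 0"
    by (rule has_integral_unique)
  then show ?thesis by (simp add: field_simps)
qed

lemma legendre_0: "legendre 0 = 1"
  by (simp add: legendre_def)

lemma poly_legendre_2: "poly (legendre 2) t = (3 * t\<^sup>2 - 1) / 2"
  by (simp add: legendre_def numeral_2_eq_2 pderiv_mult pderiv_pCons field_simps)

lemma abs_legendre_coeff_2: "abs_legendre_coeff 2 = 1 / 8"
proof -
  \<comment> \<open>An antiderivative of \<open>t * P(t)\<close> for the degree-two polynomial; the
    integral is split at 0, where the sign of \<open>t\<close> changes.\<close>
  define F :: "real poly" where "F = [:0, 0, -1/4, 0, 3/8:]"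
  have F: "poly (pderiv F) t = t * poly (legendre 2) t" for t
    by (simp add: F_def pderiv_pCons poly_legendre_2 power2_eq_square field_simps)
  have FD: "((\<lambda>t. poly F t) has_vector_derivative poly (pderiv F) t) (at t within S)" for t S
    by (auto intro: DERIV_subset poly_DERIV simp flip: has_real_derivative_iff_has_vector_derivative)
  have v: "poly F 1 - poly F 0 = 1 / 8" "- (poly F 0 - poly F (- 1)) = 1 / 8"
    by (simp_all add: F_def)
  have "((\<lambda>t. poly (pderiv F) t) has_integral 1 / 8) {0..1}"
    unfolding v(1) [symmetric] by (rule fundamental_theorem_of_calculus) (auto intro: FD)
  then have 1: "((\<lambda>t. \<bar>t\<bar> * poly (legendre 2) t) has_integral 1 / 8) {0..1}"
    by (rule has_integral_eq [rotated]) (simp add: F)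
  have "((\<lambda>t. - poly (pderiv F) t) has_integral 1 / 8) {- 1..0}"
    unfolding v(2) [symmetric]
    by (rule has_integral_neg, rule fundamental_theorem_of_calculus) (auto intro: FD)
  then have 2: "((\<lambda>t. \<bar>t\<bar> * poly (legendre 2) t) has_integral 1 / 8) {- 1..0}"
    by (rule has_integral_eq [rotated]) (simp add: F)
  show ?thesis
    using integral_unique[OF has_integral_combine[OF _ _ 2 1]] by (simp add: abs_legendre_coeff_def)
qed

section \<open>Rotation generators and the spherical Laplacian\<close>

lemma bounded_linear_vec_eq_sum:
  fixes f :: "real^'n \<Rightarrow> real"
  assumes "bounded_linear f"
  shows "f v = (\<Sum>i\<in>UNIV. v $ i * f (axis i 1))"
proof -
  interpret bounded_linear f by fact
  have "f v = f (\<Sum>i\<in>UNIV. v $ i *\<^sub>R axis i 1)"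
    using basis_expansion[of v] by (simp add: scalar_mult_eq_scaleR)
  then show ?thesis by (simp add: sum scaleR)
qed

text \<open>Based on the Frechet derivative, so that the sum, product and chain rules for
  \<open>has_derivative\<close> carry over directly to polynomial functions.\<close>

definition partial :: "'n::finite \<Rightarrow> (real^'n \<Rightarrow> real) \<Rightarrow> real^'n \<Rightarrow> real" where
  "partial i f x = frechet_derivative f (at x) (axis i 1)"

lemma partial_eq:
  assumes "(f has_derivative f') (at x)"
  shows "partial i f x = f' (axis i 1)"
  using frechet_derivative_at[OF assms] by (simp add: partial_def)

lemma real_polynomial_function_differentiable:
  assumes "real_polynomial_function f"
  shows "f differentiable (at x)"
  using assms
  by (induction rule: real_polynomial_function.induct)
     (auto intro: differentiable_mult bounded_linear_imp_differentiable)

lemma real_polynomial_function_has_derivative: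
  assumes "real_polynomial_function f"
  shows "(f has_derivative (\<lambda>v. \<Sum>i\<in>UNIV. v $ i * partial i f x)) (at x)"
proof -
  have D: "(f has_derivative frechet_derivative f (at x)) (at x)"
    using real_polynomial_function_differentiable[OF assms] by (simp add: frechet_derivative_works)
  moreover have "frechet_derivative f (at x) = (\<lambda>v. \<Sum>i\<in>UNIV. v $ i * partial i f x)"
    unfolding partial_def by (rule ext, rule bounded_linear_vec_eq_sum) (rule has_derivative_bounded_linear[OF D])
  ultimately show ?thesis by simp
qed

lemma partial_linear: "bounded_linear f \<Longrightarrow> partial i f = (\<lambda>x. f (axis i 1))"
  by (rule ext, rule partial_eq) (rule bounded_linear_imp_has_derivative)

lemma partial_const [simp]: "partial i (\<lambda>x. c) = (\<lambda>x. 0)"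
  by (rule ext, subst partial_eq[where f' = "\<lambda>_. 0"]) auto

lemma partial_add:
  assumes "real_polynomial_function f" "real_polynomial_function g"
  shows "partial i (\<lambda>x. f x + g x) = (\<lambda>x. partial i f x + partial i g x)"
  by (rule ext, subst partial_eq[OF has_derivative_add[OF assms[THEN real_polynomial_function_has_derivative]]])
     (simp add: axis_def if_distrib[where f = "\<lambda>x. x * _"] cong: if_cong)

lemma partial_mult:
  assumes "real_polynomial_function f" "real_polynomial_function g"
  shows "partial i (\<lambda>x. f x * g x) = (\<lambda>x. f x * partial i g x + partial i f x * g x)"
  by (rule ext, subst partial_eq[OF has_derivative_mult[OF assms[THEN real_polynomial_function_has_derivative]]])
     (simp add: axis_def if_distrib[where f = "\<lambda>x. x * _"] cong: if_cong)

lemma real_polynomial_function_partial [intro]: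
  assumes "real_polynomial_function f"
  shows "real_polynomial_function (partial i f)"
  using assms
  by (induction rule: real_polynomial_function.induct) (auto simp: partial_linear partial_add partial_mult)

lemma real_polynomial_function_nth [intro]: "real_polynomial_function (\<lambda>x. x $ i)"
  by (intro real_polynomial_function.intros bounded_linear_vec_nth)

lemma partial_nth: "partial i (\<lambda>x. x $ j) = (\<lambda>x. if i = j then 1 else 0)"
  by (subst partial_linear[OF bounded_linear_vec_nth]) (simp add: axis_def fun_eq_iff)

text \<open>By induction on the construction of polynomial functions: linear functions have constant
  partials, and the product rule gives an expression symmetric in \<open>i\<close> and
  \<open>j\<close>.\<close>

lemma partial_commute:
  assumes "real_polynomial_function f"
  shows "partial i (partial j f) = partial j (partial i f)"
  using assms
  by (induction rule: real_polynomial_function.induct)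
     (simp_all add: partial_linear partial_add partial_mult fun_eq_iff real_polynomial_function_partial
       real_polynomial_function.intros)

lemma partial_diff:
  assumes "real_polynomial_function f" "real_polynomial_function g"
  shows "partial i (\<lambda>x. f x - g x) = (\<lambda>x. partial i f x - partial i g x)"
  by (rule ext, subst partial_eq[OF has_derivative_diff[OF assms[THEN real_polynomial_function_has_derivative]]])
     (simp add: axis_def if_distrib[where f = "\<lambda>x. x * _"] cong: if_cong)

text \<open>The derivative along the vector field that generates rotations of the plane of
  coordinates \<open>i\<close> and \<open>j\<close>; it is tangent to every sphere around the
  origin.\<close>

definition rotgen :: "'n::finite \<Rightarrow> 'n \<Rightarrow> (real^'n \<Rightarrow> real) \<Rightarrow> real^'n \<Rightarrow> real" where
  "rotgen i j f y = y $ i * partial j f y - y $ j * partial i f y"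

lemma real_polynomial_function_rotgen [intro]:
  "real_polynomial_function f \<Longrightarrow> real_polynomial_function (rotgen i j f)"
  unfolding rotgen_def
  by (intro real_polynomial_function_diff real_polynomial_function.intros(4)
    real_polynomial_function_nth real_polynomial_function_partial)

lemma rotgen_mult:
  assumes "real_polynomial_function f" "real_polynomial_function g"
  shows "rotgen i j (\<lambda>x. f x * g x) y = f y * rotgen i j g y + rotgen i j f y * g y"
  using assms by (simp add: rotgen_def partial_mult algebra_simps)

text \<open>Built from the generators, the operator needs no coordinates on the sphere, and its
  symmetry reduces to integration by parts for each generator.\<close>

definition sphere_laplacian :: "(real^3 \<Rightarrow> real) \<Rightarrow> real^3 \<Rightarrow> real" where
  "sphere_laplacian f y =
     rotgen 1 2 (rotgen 1 2 f) y + rotgen 2 3 (rotgen 2 3 f) y + rotgen 3 1 (rotgen 3 1 f) y"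

lemma rotgen_rotgen:
  assumes "real_polynomial_function f" "i \<noteq> j"
  shows "rotgen i j (rotgen i j f) y = 
    (y $ i)\<^sup>2 * partial j (partial j f) y + (y $ j)\<^sup>2 * partial i (partial i f) y
     - 2 * y $ i * y $ j * partial i (partial j f) y - y $ i * partial i f y - y $ j * partial j f y"
proof -
  have p: "real_polynomial_function (\<lambda>y. y $ i * partial j f y)" "real_polynomial_function (partial j f)"
      "real_polynomial_function (\<lambda>y. y $ j * partial i f y)" "real_polynomial_function (partial i f)"
    using assms by (auto intro: real_polynomial_function.intros)
  have "rotgen i j f = (\<lambda>y. y $ i * partial j f y - y $ j * partial i f y)"
    by (simp add: rotgen_def fun_eq_iff)
  then show ?thesis
    using assms(2)
    unfolding rotgen_def[of i j "rotgen i j f"]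
    by (simp add: partial_diff p partial_mult[OF real_polynomial_function_nth] partial_nth
      partial_commute[OF assms(1), of j i] algebra_simps power2_eq_square)
qed

text \<open>With the Euler operator \<open>E\<close>, this is
  \<open>|y|^2 Delta - E (E + 1)\<close>, expanded so that only partial derivatives occur. On
  harmonic homogeneous functions the first summand drops out and \<open>E\<close> becomes the
  degree.\<close>

lemma sphere_laplacian_eq:
  assumes "real_polynomial_function f"
  shows "sphere_laplacian f y = (y \<bullet> y) * (\<Sum>i\<in>UNIV. partial i (partial i f) y)
    - (\<Sum>i\<in>UNIV. \<Sum>j\<in>UNIV. y $ i * y $ j * partial i (partial j f) y) - 2 * (\<Sum>i\<in>UNIV. y $ i * partial i f y)"
  using partial_commute[OF assms, of 1 2] partial_commute[OF assms, of 2 3] partial_commute[OF assms, of 1 3]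
  by (simp add: sphere_laplacian_def rotgen_rotgen[OF assms] sum_3 inner_vec_def algebra_simps power2_eq_square)

section \<open>Invariant integration on the sphere\<close>

definition axis_rotation :: "3 \<Rightarrow> 3 \<Rightarrow> real \<Rightarrow> real^3^3" where
  "axis_rotation i j \<theta> = (\<chi> k m.
     if k = i then (if m = i then cos \<theta> else if m = j then - sin \<theta> else 0)
     else if k = j then (if m = i then sin \<theta> else if m = j then cos \<theta> else 0)
     else if k = m then 1 else 0)"

lemma rotation_matrix_axis_rotation:
  assumes "i \<noteq> j"
  shows "rotation_matrix (axis_rotation i j \<theta>)"
proof -
  have [simp]: "cos \<theta> * cos \<theta> + sin \<theta> * sin \<theta> = 1" "sin \<theta> * sin \<theta> + cos \<theta> * cos \<theta> = 1"
    using sin_cos_squared_add[of \<theta>] by (simp_all add: power2_eq_square)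
  show ?thesis
    using assms exhaust_3[of i] exhaust_3[of j]
    unfolding rotation_matrix_def orthogonal_matrix
    by (elim disjE)
       (simp_all add: axis_rotation_def vec_eq_iff forall_3 sum_3 matrix_matrix_mult_def transpose_def mat_def det_3)
qed

text \<open>In this form the angle enters only through scalar factors of fixed vectors, so the orbit
  can be differentiated term by term.\<close>

lemma axis_rotation_mult_eq:
  assumes "i \<noteq> j"
  shows "axis_rotation i j \<theta> *v y =
    y + (cos \<theta> - 1) *\<^sub>R (axis i (y $ i) + axis j (y $ j)) + sin \<theta> *\<^sub>R (axis j (y $ i) - axis i (y $ j))"
  using assms exhaust_3[of i] exhaust_3[of j]
  by (elim disjE)
     (simp_all add: axis_rotation_def vec_eq_iff forall_3 sum_3 matrix_vector_mult_def axis_def algebra_simps)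

text \<open>The velocity of the orbit is the rotation field at the current point. The statement
  covers every angle, not just 0, because the mean value theorem is applied along the orbit
  later.\<close>

lemma DERIV_axis_rotation:
  assumes f: "real_polynomial_function f" and ij: "i \<noteq> j"
  shows "((\<lambda>\<theta>. f (axis_rotation i j \<theta> *v y)) has_real_derivative
    rotgen i j f (axis_rotation i j \<theta> *v y)) (at \<theta>)"
proof -
  let ?g = "\<lambda>\<theta>. axis_rotation i j \<theta> *v y"
  define v where "v = (- sin \<theta>) *\<^sub>R (axis i (y $ i) + axis j (y $ j)) + cos \<theta> *\<^sub>R (axis j (y $ i) - axis i (y $ j))"
  have "(?g has_vector_derivative v) (at \<theta>)"
    unfolding axis_rotation_mult_eq[OF ij] v_def
    by (auto intro!: derivative_eq_intros)
  then have "(?g has_derivative (\<lambda>h. h *\<^sub>R v)) (at \<theta>)"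
    by (simp add: has_vector_derivative_def)
  from has_derivative_compose[OF this real_polynomial_function_has_derivative[OF f]]
  have "((\<lambda>\<theta>. f (?g \<theta>)) has_derivative (\<lambda>h. \<Sum>k\<in>UNIV. (h *\<^sub>R v) $ k * partial k f (?g \<theta>))) (at \<theta>)" .
  moreover have "(\<lambda>h. \<Sum>k\<in>UNIV. (h *\<^sub>R v) $ k * partial k f (?g \<theta>)) = (*) (rotgen i j f (?g \<theta>))"
  proof
    fix h
    \<comment> \<open>The velocity is the current point, projected to the plane of \<open>i\<close>
      and \<open>j\<close> and turned by a right angle; all other coordinates are at rest.\<close>
    have *: "v $ k = (if k = i then - (?g \<theta> $ j) else if k = j then ?g \<theta> $ i else 0)" for k
      using ij unfolding axis_rotation_mult_eq[OF ij] v_def by (simp add: axis_def algebra_simps)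
    have "(\<Sum>k\<in>UNIV. (h *\<^sub>R v) $ k * partial k f (?g \<theta>)) =
        (\<Sum>k\<in>{i, j}. (h *\<^sub>R v) $ k * partial k f (?g \<theta>))"
      by (rule sum.mono_neutral_right) (simp_all add: *)
    also have "\<dots> = rotgen i j f (?g \<theta>) * h"
      using ij by (simp add: rotgen_def * algebra_simps)
    finally show "(\<Sum>k\<in>UNIV. (h *\<^sub>R v) $ k * partial k f (?g \<theta>)) = rotgen i j f (?g \<theta>) * h" .
  qed
  ultimately show ?thesis by (simp add: has_field_derivative_def)
qed

lemma continuous_on_real_polynomial_function:
  "real_polynomial_function f \<Longrightarrow> continuous_on S f"
  by (simp add: continuous_on_polymonial_function real_polynomial_function_eq)

lemma norm_rotation: "rotation_matrix Q \<Longrightarrow> norm (Q *v x) = norm x" for Q :: "real^3^3"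
  unfolding rotation_matrix_def
  by (metis orthogonal_transformation_matrix orthogonal_transformation_norm matrix_vector_mul_linear matrix_of_matrix_vector_mul)

locale uniform_sphere =
  fixes \<sigma> :: "(real^3) measure"
  assumes uniform: "uniform_sphere_measure \<sigma>"
begin

sublocale prob_space \<sigma>
  using uniform by (simp add: uniform_sphere_measure_def)

lemma sets_eq: "sets \<sigma> = sets (restrict_space borel (sphere 0 1))"
  using uniform by (simp add: uniform_sphere_measure_def sphere_borel_def)

lemma space_eq: "space \<sigma> = sphere 0 1"
  using sets_eq_imp_space_eq[OF sets_eq] by (simp add: space_restrict_space)

lemma borel_measurable_continuous_on_sphere:
  "continuous_on (sphere 0 1) f \<Longrightarrow> f \<in> borel_measurable \<sigma>"
  by (subst measurable_cong_sets[OF sets_eq refl]) (rule borel_measurable_continuous_on_restrict)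

lemma integrable_continuous_on_sphere:
  fixes f :: "real^3 \<Rightarrow> 'b::{second_countable_topology, banach}"
  assumes "continuous_on (sphere 0 1) f"
  shows "integrable \<sigma> f"
proof -
  have "bounded (f ` sphere 0 1)"
    using assms by (intro compact_imp_bounded compact_continuous_image) auto
  then obtain B where "\<And>x. norm x = 1 \<Longrightarrow> norm (f x) \<le> B"
    by (metis bounded_iff imageI mem_sphere_0)
  then show ?thesis
    using assms by (intro integrable_const_bound[where B = B] borel_measurable_continuous_on_sphere) (auto simp: space_eq)
qed

lemma integrable_poly_function: "real_polynomial_function f \<Longrightarrow> integrable \<sigma> f"
  by (intro integrable_continuous_on_sphere continuous_on_real_polynomial_function)

lemma integral_rotation:
  fixes f :: "real^3 \<Rightarrow> 'b::{second_countable_topology, banach}"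
  assumes "continuous_on (sphere 0 1) f" and Q: "rotation_matrix Q"
  shows "(\<integral>y. f (Q *v y) \<partial>\<sigma>) = (\<integral>y. f y \<partial>\<sigma>)"
proof -
  have "(*v) Q \<in> measurable (restrict_space borel (sphere 0 1)) (restrict_space borel (sphere 0 1))"
    by (intro measurable_restrict_space3 borel_measurable_continuous_onI linear_continuous_on) (auto simp: norm_rotation[OF Q])
  then have m: "(*v) Q \<in> measurable \<sigma> \<sigma>"
    by (simp add: measurable_cong_sets[OF sets_eq sets_eq])
  have "(\<integral>y. f y \<partial>distr \<sigma> \<sigma> ((*v) Q)) = (\<integral>y. f (Q *v y) \<partial>\<sigma>)"
    using m borel_measurable_continuous_on_sphere[OF assms(1)] by (rule integral_distr)
  then show ?thesis
    using uniform Q by (simp add: uniform_sphere_measure_def)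
qed

text \<open>The integral of \<open>f\<close> composed with a rotation does not depend on the angle.
  Its difference quotients at angle 0 therefore vanish, and dominated convergence identifies their
  limit with the integral of the generator applied to \<open>f\<close>.\<close>

lemma integral_rotgen:
  assumes f: "real_polynomial_function f" and ij: "i \<noteq> j"
  shows "(\<integral>y. rotgen i j f y \<partial>\<sigma>) = 0"
proof -
  define \<epsilon> where "\<epsilon> n = inverse (real (Suc n))" for n
  let ?g = "\<lambda>n y. axis_rotation i j (\<epsilon> n) *v y"
  let ?s = "\<lambda>n y. (f (?g n y) - f y) / \<epsilon> n"
  have \<epsilon>: "\<epsilon> n > 0" for n by (simp add: \<epsilon>_def)
  have \<epsilon>0: "\<epsilon> \<longlonglongrightarrow> 0"
    unfolding \<epsilon>_def by (rule LIMSEQ_inverse_real_of_nat)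
  have c: "continuous_on S f" "continuous_on S (rotgen i j f)" for S
    using f by (auto intro: continuous_on_real_polynomial_function)
  have rot0: "axis_rotation i j 0 *v y = y" for y
    by (simp add: axis_rotation_mult_eq[OF ij])
  have "bounded (rotgen i j f ` sphere 0 1)"
    by (intro compact_imp_bounded compact_continuous_image c) auto
  then obtain B where B: "\<And>x. norm x = 1 \<Longrightarrow> \<bar>rotgen i j f x\<bar> \<le> B"
    by (metis bounded_iff imageI mem_sphere_0 real_norm_def)
  have cg: "continuous_on (sphere 0 1) (\<lambda>y. f (Q *v y))" for Q
    by (intro continuous_on_compose2[OF c(1)[of UNIV]] linear_continuous_on) auto
  have int: "integrable \<sigma> (\<lambda>y. f (Q *v y))" "integrable \<sigma> f" for Q
    by (intro integrable_continuous_on_sphere cg c)+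
  have "(\<lambda>n. \<integral>y. ?s n y \<partial>\<sigma>) \<longlonglongrightarrow> (\<integral>y. rotgen i j f y \<partial>\<sigma>)"
  proof (rule integral_dominated_convergence[where w = "\<lambda>_. B"])
    show "rotgen i j f \<in> borel_measurable \<sigma>" "?s n \<in> borel_measurable \<sigma>" for n
      by (intro borel_measurable_continuous_on_sphere continuous_intros c cg | simp add: \<epsilon>_def)+
    show "AE y in \<sigma>. (\<lambda>n. ?s n y) \<longlonglongrightarrow> rotgen i j f y"
    proof (rule AE_I2)
      fix y
      have "((\<lambda>h. (f (axis_rotation i j h *v y) - f y) / h) \<longlongrightarrow> rotgen i j f y) (at 0)"
        using DERIV_axis_rotation[OF f ij, of y 0] by (simp add: rot0 DERIV_def)
      moreover have "filterlim \<epsilon> (at 0) sequentially"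
        using \<epsilon>0 \<epsilon> by (auto simp: filterlim_at less_imp_neq[THEN not_sym])
      ultimately show "(\<lambda>n. ?s n y) \<longlonglongrightarrow> rotgen i j f y"
        by (rule filterlim_compose)
    qed
    show "AE y in \<sigma>. norm (?s n y) \<le> B" for n
    proof (rule AE_I2)
      fix y assume y: "y \<in> space \<sigma>"
      \<comment> \<open>The intermediate point lies on the orbit of \<open>y\<close>, hence on the
        unit sphere, so the bound \<open>B\<close> dominates all difference quotients at
        once.\<close>
      obtain z where "f (?g n y) - f (axis_rotation i j 0 *v y) = (\<epsilon> n - 0) * rotgen i j f (axis_rotation i j z *v y)"
        using MVT2[OF \<epsilon>[of n] DERIV_axis_rotation[OF f ij, of y]] by blast
      then have "?s n y = rotgen i j f (axis_rotation i j z *v y)"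
        using \<epsilon>[of n] by (simp add: rot0)
      then show "norm (?s n y) \<le> B"
        using y by (simp add: space_eq B norm_rotation[OF rotation_matrix_axis_rotation[OF ij]])
    qed
  qed simp
  moreover have "(\<integral>y. ?s n y \<partial>\<sigma>) = 0" for n
    using integral_rotation[OF c(1) rotation_matrix_axis_rotation[OF ij]] int by simp
  ultimately have "(\<lambda>n. 0) \<longlonglongrightarrow> (\<integral>y. rotgen i j f y \<partial>\<sigma>)"
    by (simp only:)
  then show ?thesis
    by (simp add: LIMSEQ_const_iff)
qed

text \<open>The product rule and the vanishing integral make each generator antisymmetric; its
  square is then symmetric.\<close>

lemma integral_rotgen_rotgen:
  assumes f: "real_polynomial_function f" and g: "real_polynomial_function g" and ij: "i \<noteq> j"
  shows "(\<integral>y. rotgen i j (rotgen i j f) y * g y \<partial>\<sigma>) = (\<integral>y. f y * rotgen i j (rotgen i j g) y \<partial>\<sigma>)"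
proof -
  note p = real_polynomial_function.intros(4) real_polynomial_function_rotgen f g
  have parts: "(\<integral>y. rotgen i j f y * g y \<partial>\<sigma>) = - (\<integral>y. f y * rotgen i j g y \<partial>\<sigma>)"
    if f: "real_polynomial_function f" and g: "real_polynomial_function g" for f g
  proof -
    have "(\<integral>y. f y * rotgen i j g y \<partial>\<sigma>) + (\<integral>y. rotgen i j f y * g y \<partial>\<sigma>) =
        (\<integral>y. rotgen i j (\<lambda>x. f x * g x) y \<partial>\<sigma>)"
      unfolding rotgen_mult[OF f g]
      by (intro Bochner_Integration.integral_add [symmetric] integrable_poly_function p f g)
    also have "\<dots> = 0"
      by (intro integral_rotgen p f g ij)
    finally show ?thesis by simp
  qed
  show ?thesis
    using parts[of "rotgen i j f" g] parts[of f "rotgen i j g"] by (simp add: p)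
qed

lemma integral_sphere_laplacian:
  assumes f: "real_polynomial_function f" and g: "real_polynomial_function g"
  shows "(\<integral>y. sphere_laplacian f y * g y \<partial>\<sigma>) = (\<integral>y. f y * sphere_laplacian g y \<partial>\<sigma>)"
proof -
  note p = real_polynomial_function.intros(4) real_polynomial_function_rotgen f g
  have i: "integrable \<sigma> (\<lambda>y. rotgen i j (rotgen i j f) y * g y)"
    "integrable \<sigma> (\<lambda>y. f y * rotgen i j (rotgen i j g) y)" for i j
    by (intro integrable_poly_function p)+
  show ?thesis
    unfolding sphere_laplacian_def distrib_left distrib_right
    by (simp add: i integral_rotgen_rotgen[OF f g])
qed

end

section \<open>The Funk--Hecke formula\<close>

lemma partial_cmult:
  assumes "real_polynomial_function f"
  shows "partial i (\<lambda>x. c * f x) = (\<lambda>x. c * partial i f x)"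
  using partial_mult[OF real_polynomial_function.intros(2) assms] by simp

lemma partial_sum:
  assumes "finite A" "\<And>k. k \<in> A \<Longrightarrow> real_polynomial_function (f k)"
  shows "partial i (\<lambda>x. \<Sum>k\<in>A. f k x) = (\<lambda>x. \<Sum>k\<in>A. partial i (f k) x)"
  using assms
  by (induction rule: finite_induct) (simp_all add: partial_add real_polynomial_function_sum)

section \<open>Eigenfunctions of the spherical Laplacian\<close>

text \<open>Asking for the equation only on the unit sphere admits zonal Legendre functions, which
  need not be homogeneous, alongside harmonic homogeneous polynomials.\<close>

definition sphere_eigenfunction :: "nat \<Rightarrow> (real^3 \<Rightarrow> real) \<Rightarrow> bool" where
  "sphere_eigenfunction l f \<longleftrightarrow> real_polynomial_function f \<and>
     (\<forall>y. norm y = 1 \<longrightarrow> sphere_laplacian f y = - (real l * (real l + 1)) * f y)"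

text \<open>Differentiate the homogeneity relation in \<open>r\<close> at \<open>r = 1\<close>, in
  two ways.\<close>

lemma euler_homogeneous:
  assumes f: "real_polynomial_function f" and hom: "\<And>r x. f (r *\<^sub>R x) = r ^ l * f x"
  shows "(\<Sum>i\<in>UNIV. y $ i * partial i f y) = real l * f y"
proof -
  have "((\<lambda>r. r *\<^sub>R y) has_derivative (\<lambda>h. h *\<^sub>R y)) (at 1)"
    by (auto intro!: derivative_eq_intros)
  from has_derivative_compose[OF this real_polynomial_function_has_derivative[OF f]]
  have "((\<lambda>r. r ^ l * f y) has_derivative (\<lambda>h. \<Sum>i\<in>UNIV. (h *\<^sub>R y) $ i * partial i f y)) (at 1)"
    by (simp add: hom)
  moreover have "(\<lambda>h. \<Sum>i\<in>UNIV. (h *\<^sub>R y) $ i * partial i f y) = (*) (\<Sum>i\<in>UNIV. y $ i * partial i f y)"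
    by (simp add: fun_eq_iff sum_distrib_left mult_ac)
  ultimately have "((\<lambda>r. r ^ l * f y) has_real_derivative (\<Sum>i\<in>UNIV. y $ i * partial i f y)) (at 1)"
    by (simp add: has_field_derivative_def)
  moreover have "((\<lambda>r. r ^ l * f y) has_real_derivative real l * f y) (at 1)"
    by (auto intro!: derivative_eq_intros)
  ultimately show ?thesis by (rule DERIV_unique)
qed

text \<open>Euler's identity for \<open>f\<close>, and again for \<open>E\<close>, which is
  homogeneous of the same degree, gives \<open>l (l - 1) f\<close> for the sum of the terms
  \<open>y_i y_j\<close> times second partials. With the Laplacian zero this leaves
  \<open>- l (l - 1) - 2 l = - l (l + 1)\<close>.\<close>

lemma sphere_eigenfunction_homogeneous:
  assumes f: "real_polynomial_function f" and hom: "\<And>r x. f (r *\<^sub>R x) = r ^ l * f x"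
    and harm: "\<And>x. (\<Sum>i\<in>UNIV. partial i (partial i f) x) = 0"
  shows "sphere_eigenfunction l f"
proof -
  have p: "real_polynomial_function (\<lambda>y. y $ i * partial i f y)" for i
    using f by (intro real_polynomial_function.intros(4)) auto
  define E where "E = (\<lambda>y. \<Sum>i\<in>UNIV. y $ i * partial i f y)"
  have E: "E = (\<lambda>y. real l * f y)"
    unfolding E_def by (rule ext) (rule euler_homogeneous[OF f hom])
  have "E (r *\<^sub>R x) = r ^ l * E x" for r x
    by (simp add: E hom)
  moreover have "real_polynomial_function E"
    unfolding E_def by (intro real_polynomial_function_sum p) auto
  ultimately have "(\<Sum>j\<in>UNIV. y $ j * partial j E y) = real l * E y" for y
    by (intro euler_homogeneous)
  moreover have "partial j E y = partial j f y + (\<Sum>i\<in>UNIV. y $ i * partial j (partial i f) y)" for j y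
  proof -
    have "partial j E y = (\<Sum>i\<in>UNIV. y $ i * partial j (partial i f) y + (if j = i then 1 else 0) * partial i f y)"
      unfolding E_def using f
      by (subst partial_sum) (auto intro: p simp: partial_mult[OF real_polynomial_function_nth] real_polynomial_function_partial partial_nth)
    then show ?thesis
      by (simp add: sum.distrib if_distrib[where f = "\<lambda>x. x * _"] cong: if_cong)
  qed
  ultimately have "(\<Sum>j\<in>UNIV. y $ j * partial j f y) +
      (\<Sum>i\<in>UNIV. \<Sum>j\<in>UNIV. y $ i * y $ j * partial i (partial j f) y) = real l * (real l * f y)" for y
    by (simp add: E distrib_left sum.distrib sum_distrib_left mult.assoc)
  then have "sphere_laplacian f y = - (real l * (real l + 1)) * f y" if "norm y = 1" for y
    unfolding sphere_laplacian_eq[OF f] harm euler_homogeneous[OF f hom]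
    by (simp add: algebra_simps eq_diff_eq)
  then show ?thesis
    using f by (simp add: sphere_eigenfunction_def)
qed

lemma real_polynomial_function_zonal: "real_polynomial_function (\<lambda>y. poly p (x \<bullet> y))"
proof (induction p)
  case (pCons a p)
  then show ?case
    unfolding poly_pCons
    by (intro real_polynomial_function.intros(2,3,4) real_polynomial_function.intros(1)[OF bounded_linear_inner_right])
qed (auto intro: real_polynomial_function.intros)

lemma partial_zonal: "partial i (\<lambda>y. poly p (x \<bullet> y)) = (\<lambda>y. x $ i * poly (pderiv p) (x \<bullet> y))"
proof
  fix y
  have "((\<lambda>y. poly p (x \<bullet> y)) has_derivative (\<lambda>v. (x \<bullet> v) * poly (pderiv p) (x \<bullet> y))) (at y)"
    by (rule DERIV_compose_FDERIV[OF poly_DERIV]) (auto intro!: derivative_eq_intros)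
  then show "partial i (\<lambda>y. poly p (x \<bullet> y)) y = x $ i * poly (pderiv p) (x \<bullet> y)"
    by (simp add: partial_eq inner_axis)
qed

text \<open>For unit vectors the spherical Laplacian acts on functions of
  \<open>t = x \<bullet> y\<close> as the Legendre differential operator in \<open>t\<close>, which
  brings in \<open>legendre_ode\<close>.\<close>

lemma sphere_laplacian_zonal:
  assumes "norm x = 1" "norm y = 1"
  shows "sphere_laplacian (\<lambda>y. poly p (x \<bullet> y)) y =
    (1 - (x \<bullet> y)\<^sup>2) * poly (pderiv (pderiv p)) (x \<bullet> y) - 2 * (x \<bullet> y) * poly (pderiv p) (x \<bullet> y)"
proof -
  have *: "x \<bullet> x = 1" "y \<bullet> y = 1"
    using assms by (simp_all add: norm_eq_1)
  have sums: "(\<Sum>i\<in>UNIV. x $ i * (x $ i * A)) = (x \<bullet> x) * A"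
    "(\<Sum>i\<in>UNIV. \<Sum>j\<in>UNIV. y $ i * y $ j * (x $ j * (x $ i * A))) = (x \<bullet> y)\<^sup>2 * A"
    "(\<Sum>i\<in>UNIV. y $ i * (x $ i * A)) = (x \<bullet> y) * A" for A
    by (simp_all add: inner_vec_def sum_3 algebra_simps power2_eq_square)
  show ?thesis
    unfolding sphere_laplacian_eq[OF real_polynomial_function_zonal] partial_zonal
      partial_cmult[OF real_polynomial_function_zonal] sums *
    by (simp add: algebra_simps)
qed

lemma sphere_eigenfunction_legendre:
  "norm x = 1 \<Longrightarrow> sphere_eigenfunction l (\<lambda>y. poly (legendre l) (x \<bullet> y))"
  by (simp add: sphere_eigenfunction_def real_polynomial_function_zonal sphere_laplacian_zonal legendre_ode)

text \<open>An approximate identity: as \<open>k\<close> grows, this polynomial concentrates its mass at \<open>t = 1\<close>.\<close>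

definition peak :: "nat \<Rightarrow> real poly" where
  "peak k = smult (real (Suc k)) ([:1/2, 1/2:] ^ k)"

text \<open>The value 2 is the length of the interval, so that the zonal function made from a peak
  has mean 1 on the sphere.\<close>

lemma integral_peak: "integral {-1..1} (poly (peak k)) = 2"
proof -
  have "pderiv (smult 2 ([:1/2, 1/2:] ^ Suc k)) = peak k"
    by (simp add: peak_def pderiv_smult pderiv_power_Suc pderiv_pCons add_divide_distrib del: power_Suc)
  then have "(poly (peak k) has_integral 2) {-1..1}"
    using integral_pderiv[of "smult 2 ([:1/2, 1/2:] ^ Suc k)"] by simp
  then show ?thesis by (rule integral_unique)
qed

lemma peak_nonneg: "t \<ge> -1 \<Longrightarrow> poly (peak k) t \<ge> 0"
  by (simp add: peak_def poly_power)

text \<open>Put \<open>u = (1 + t) / 2\<close>; then \<open>1 - t = 2 - 2 u\<close>, and a factor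
  \<open>u\<close> turns one peak into a multiple of the next. The mean of \<open>1 - t\<close>
  under a peak thus follows from the total masses alone.\<close>

lemma peak_Suc: "(1 - t) * poly (peak k) t = 2 * poly (peak k) t - 2 * (real k + 1) / (real k + 2) * poly (peak (Suc k)) t"
proof -
  define u where "u = 1 / 2 + t / 2"
  have e: "poly (peak k) t = (real k + 1) * u ^ k" "poly (peak (Suc k)) t = (real k + 2) * (u * u ^ k)" "1 - t = 2 - 2 * u"
    by (simp_all add: peak_def poly_power u_def algebra_simps)
  have c: "2 * (real k + 1) / (real k + 2) * ((real k + 2) * (u * u ^ k)) = 2 * (real k + 1) * (u * u ^ k)"
    by simp
  show ?thesis
    unfolding e c by (simp add: algebra_simps)
qed

lemma weierstrass_poly:
  fixes g :: "real \<Rightarrow> real"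
  assumes "continuous_on {-1..1} g" "e > 0"
  shows "\<exists>p. \<forall>t\<in>{-1..1}. \<bar>g t - poly p t\<bar> < e"
proof -
  obtain h where h: "polynomial_function h" "\<And>x. x \<in> {-1..1} \<Longrightarrow> norm (g x - h x) < e"
    using Stone_Weierstrass_polynomial_function[OF compact_Icc assms] by blast
  then obtain a n where "h = (\<lambda>x. \<Sum>i\<le>n. a i * x ^ i)"
    using real_polynomial_function_iff_sum real_polynomial_function_eq by metis
  then have "h x = poly (\<Sum>i\<le>n. monom (a i) i) x" for x
    by (simp add: poly_sum poly_monom)
  then show ?thesis using h(2) by (metis real_norm_def)
qed

lemma abs_inner_le_1: "norm x = 1 \<Longrightarrow> norm y = 1 \<Longrightarrow> \<bar>x \<bullet> y\<bar> \<le> 1" for x y :: "'a::real_inner"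
  using Cauchy_Schwarz_ineq2[of x y] by simp

lemma continuous_on_zonal: "continuous_on S (\<lambda>y. poly p (x \<bullet> y))"
  by (intro continuous_on_real_polynomial_function real_polynomial_function_zonal)

context uniform_sphere
begin

text \<open>Moving the symmetric operator from one factor to the other multiplies the integral by
  two eigenvalues, which differ by \<open>(j - l) (j + l + 1)\<close> up to sign.\<close>

lemma integral_legendre_eigenfunction:
  assumes f: "sphere_eigenfunction l f" and x: "norm x = 1" and "j \<noteq> l"
  shows "(\<integral>y. poly (legendre j) (x \<bullet> y) * f y \<partial>\<sigma>) = 0"
proof -
  let ?g = "\<lambda>y. poly (legendre j) (x \<bullet> y)" and ?c = "\<lambda>l. - (real l * (real l + 1))"
  let ?I = "\<integral>y. poly (legendre j) (x \<bullet> y) * f y \<partial>\<sigma>"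
  have g: "sphere_eigenfunction j ?g"
    by (rule sphere_eigenfunction_legendre[OF x])
  have "?c j * ?I = (\<integral>y. sphere_laplacian ?g y * f y \<partial>\<sigma>)"
    unfolding integral_mult_right_zero [symmetric] using g
    by (intro Bochner_Integration.integral_cong) (auto simp: sphere_eigenfunction_def space_eq)
  also have "\<dots> = (\<integral>y. ?g y * sphere_laplacian f y \<partial>\<sigma>)"
    using f g by (intro integral_sphere_laplacian) (auto simp: sphere_eigenfunction_def)
  also have "\<dots> = ?c l * ?I"
    unfolding integral_mult_right_zero [symmetric] using f
    by (intro Bochner_Integration.integral_cong) (auto simp: sphere_eigenfunction_def space_eq)
  finally have "(real j - real l) * (real j + real l + 1) * ?I = 0"
    by (simp add: algebra_simps)
  then show ?thesis
    using \<open>j \<noteq> l\<close> by (simp del: of_nat_add)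
qed

text \<open>In the Legendre expansion of \<open>p\<close> only degree \<open>l\<close> contributes,
  and its coefficient is read off by orthogonality on the interval. One factor, the integral of
  \<open>f\<close> against the zonal Legendre function, is still to be determined.\<close>

lemma integral_zonal_eigenfunction:
  assumes f: "sphere_eigenfunction l f" and x: "norm x = 1"
  shows "(\<integral>y. poly p (x \<bullet> y) * f y \<partial>\<sigma>) =
    (2 * real l + 1) / 2 * integral {-1..1} (\<lambda>t. poly p t * poly (legendre l) t) *
    (\<integral>y. poly (legendre l) (x \<bullet> y) * f y \<partial>\<sigma>)"
proof -
  \<comment> \<open>The bound exceeds \<open>l\<close> as well as the degree of \<open>p\<close>, so
    the index \<open>l\<close> occurs in the sum even when its coefficient is 0.\<close>
  define K where "K = Suc (max l (degree p))"
  have l: "l \<in> {..<K}" and "degree p < K"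
    by (auto simp: K_def)
  then obtain b where p: "p = (\<Sum>j<K. smult (b j) (legendre j))"
    using poly_legendre_expansion by blast
  have i: "(\<lambda>t. poly p t * poly q t) integrable_on {-1..1}" for p q :: "real poly"
    by (intro integrable_continuous_interval continuous_intros)
  have j: "integrable \<sigma> (\<lambda>y. poly p (x \<bullet> y) * f y)" for p
    using f by (intro integrable_poly_function real_polynomial_function.intros(4) real_polynomial_function_zonal)
      (simp add: sphere_eigenfunction_def)
  have "integral {-1..1} (\<lambda>t. poly p t * poly (legendre l) t) =
      (\<Sum>j<K. integral {-1..1} (\<lambda>t. b j * (poly (legendre j) t * poly (legendre l) t)))"
    unfolding p by (subst integral_sum [symmetric])
      (auto intro!: integrable_on_mult_right i simp: poly_sum sum_distrib_right mult.assoc)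
  also have "\<dots> = (\<Sum>j<K. if j = l then b l * (2 / (2 * real l + 1)) else 0)"
    by (intro sum.cong) (auto simp: legendre_orthogonal legendre_norm)
  finally have b: "integral {-1..1} (\<lambda>t. poly p t * poly (legendre l) t) = b l * (2 / (2 * real l + 1))"
    using l by simp
  have "(\<integral>y. poly p (x \<bullet> y) * f y \<partial>\<sigma>) = (\<Sum>j<K. \<integral>y. b j * (poly (legendre j) (x \<bullet> y) * f y) \<partial>\<sigma>)"
    unfolding p by (subst Bochner_Integration.integral_sum [symmetric])
      (auto intro!: integrable_mult_right j simp: poly_sum sum_distrib_right mult.assoc)
  also have "\<dots> = (\<Sum>j<K. if j = l then b l * (\<integral>y. poly (legendre l) (x \<bullet> y) * f y \<partial>\<sigma>) else 0)"
    by (intro sum.cong) (auto simp: integral_legendre_eigenfunction[OF f x])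
  finally have "(\<integral>y. poly p (x \<bullet> y) * f y \<partial>\<sigma>) = b l * (\<integral>y. poly (legendre l) (x \<bullet> y) * f y \<partial>\<sigma>)"
    using l by simp
  then show ?thesis
    unfolding b by (simp add: field_simps)
qed

text \<open>Archimedes' theorem for polynomials: the projection of the uniform measure to an axis is
  uniform on the interval. It is the case of degree 0 and the constant eigenfunction 1.\<close>

lemma integral_zonal:
  assumes "norm x = 1"
  shows "(\<integral>y. poly p (x \<bullet> y) \<partial>\<sigma>) = integral {-1..1} (poly p) / 2"
proof -
  have "sphere_eigenfunction 0 (\<lambda>y. 1)"
    using sphere_eigenfunction_legendre[OF assms, of 0] by (simp add: legendre_0)
  from integral_zonal_eigenfunction[OF this assms, of p] show ?thesis
    by (simp add: legendre_0 prob_space)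
qed

text \<open>Zonal peaks are nonnegative with mean 1, and the mean of
  \<open>1 - x \<bullet> y\<close> under them is \<open>2 / (k + 2)\<close>. It suffices to bound
  the deviation of \<open>f\<close> from \<open>f x\<close> by a small constant plus a multiple of
  \<open>1 - x \<bullet> y\<close>.\<close>

lemma tendsto_integral_peak:
  assumes f: "continuous_on (sphere 0 1) f" and x: "norm x = 1"
  shows "(\<lambda>k. \<integral>y. poly (peak k) (x \<bullet> y) * f y \<partial>\<sigma>) \<longlonglongrightarrow> f x"
proof (rule LIMSEQ_I)
  fix e :: real assume e: "e > 0"
  have "bounded (f ` sphere 0 1)"
    by (intro compact_imp_bounded compact_continuous_image f) auto
  then obtain B where B: "\<And>y. norm y = 1 \<Longrightarrow> \<bar>f y\<bar> \<le> B"
    by (metis bounded_iff imageI mem_sphere_0 real_norm_def)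
  obtain d where d: "d > 0" "\<And>y. norm y = 1 \<Longrightarrow> dist y x < d \<Longrightarrow> \<bar>f y - f x\<bar> < e / 2"
    using f x e unfolding continuous_on_iff
    by (metis dist_real_def half_gt_zero mem_sphere_0)
  \<comment> \<open>Away from \<open>x\<close>, \<open>1 - x \<bullet> y\<close> is at least half of
    \<open>d\<close> squared, and with this factor it outweighs the crude bound
    \<open>2 * B\<close>.\<close>
  define C where "C = 4 * B / d\<^sup>2"
  have B0: "B \<ge> 0" using B[OF x] by simp
  have near: "\<bar>f y - f x\<bar> \<le> e / 2 + C * (1 - x \<bullet> y)" if y: "norm y = 1" for y
  proof (cases "dist y x < d")
    case True
    have "C * (1 - x \<bullet> y) \<ge> 0"
      using B0 abs_inner_le_1[OF x y] by (simp add: C_def)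
    then show ?thesis using d(2)[OF y True] by simp
  next
    case False
    have "(dist y x)\<^sup>2 = 2 * (1 - x \<bullet> y)"
      using x y unfolding dist_norm power2_norm_eq_inner
      by (simp add: inner_diff_left inner_diff_right inner_commute norm_eq_1)
    moreover have "(dist y x)\<^sup>2 \<ge> d\<^sup>2"
      using False d(1) by (intro power_mono) auto
    ultimately have "d\<^sup>2 / 2 \<le> 1 - x \<bullet> y" by simp
    from mult_left_mono[OF this, of C] have "2 * B \<le> C * (1 - x \<bullet> y)"
      using B0 d(1) by (simp add: C_def)
    then show ?thesis
      using B[OF x] B[OF y] e by linarith
  qed
  obtain k0 where k0: "\<And>k. k \<ge> k0 \<Longrightarrow> C * (2 / (real k + 2)) < e / 2"
  proof -
    have "(\<lambda>k. C * (2 / (real k + 2))) \<longlonglongrightarrow> 0"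
      by real_asymp
    then show ?thesis
      using that e order_tendstoD(2)[of _ 0 sequentially "e / 2"] unfolding eventually_sequentially by (metis half_gt_zero)
  qed
  have "norm ((\<integral>y. poly (peak k) (x \<bullet> y) * f y \<partial>\<sigma>) - f x) < e" if "k \<ge> k0" for k
  proof -
    let ?g = "\<lambda>y. poly (peak k) (x \<bullet> y)"
    have i: "integrable \<sigma> (\<lambda>y. ?g y * h y)" if "continuous_on (sphere 0 1) h" for h
      by (intro integrable_continuous_on_sphere continuous_intros continuous_on_zonal that)
    have g1: "(\<integral>y. poly (peak k) (x \<bullet> y) \<partial>\<sigma>) = 1" for k
      by (simp add: integral_zonal[OF x] integral_peak)
    have "(\<integral>y. ?g y * (1 - x \<bullet> y) \<partial>\<sigma>) =
        (\<integral>y. 2 * ?g y - 2 * (real k + 1) / (real k + 2) * poly (peak (Suc k)) (x \<bullet> y) \<partial>\<sigma>)"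
      by (intro Bochner_Integration.integral_cong refl) (subst mult.commute, rule peak_Suc)
    also have "\<dots> = 2 * 1 - 2 * (real k + 1) / (real k + 2) * 1"
      by (subst Bochner_Integration.integral_diff)
        (auto simp: g1 intro!: integrable_continuous_on_sphere continuous_intros continuous_on_zonal)
    also have "\<dots> = 2 / (real k + 2)"
      by (simp add: field_simps)
    finally have g2: "(\<integral>y. ?g y * (1 - x \<bullet> y) \<partial>\<sigma>) = 2 / (real k + 2)" .
    have "(\<integral>y. ?g y * f y \<partial>\<sigma>) - f x = (\<integral>y. ?g y * (f y - f x) \<partial>\<sigma>)"
      unfolding right_diff_distrib using i[OF f] i[of "\<lambda>_. f x"] g1[of k] by simp
    then have "norm ((\<integral>y. ?g y * f y \<partial>\<sigma>) - f x) = norm (\<integral>y. ?g y * (f y - f x) \<partial>\<sigma>)"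
      by simp
    also have "\<dots> \<le> (\<integral>y. norm (?g y * (f y - f x)) \<partial>\<sigma>)"
      by (rule integral_norm_bound)
    also have "\<dots> \<le> (\<integral>y. ?g y * (e / 2 + C * (1 - x \<bullet> y)) \<partial>\<sigma>)"
    proof (rule integral_mono)
      show "integrable \<sigma> (\<lambda>y. norm (?g y * (f y - f x)))"
        by (intro integrable_norm i continuous_intros f)
      show "integrable \<sigma> (\<lambda>y. ?g y * (e / 2 + C * (1 - x \<bullet> y)))"
        by (intro i continuous_intros)
      fix y assume y: "y \<in> space \<sigma>"
      then have "?g y \<ge> 0"
        using abs_inner_le_1[OF x, of y] by (intro peak_nonneg) (simp add: space_eq)
      then show "norm (?g y * (f y - f x)) \<le> ?g y * (e / 2 + C * (1 - x \<bullet> y))"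
        using near[of y] y by (auto simp: abs_mult space_eq intro!: mult_left_mono)
    qed
    also have "\<dots> = e / 2 + C * (2 / (real k + 2))"
    proof -
      have "(\<integral>y. ?g y * (e / 2 + C * (1 - x \<bullet> y)) \<partial>\<sigma>) =
          (\<integral>y. ?g y * (e / 2) + C * (?g y * (1 - x \<bullet> y)) \<partial>\<sigma>)"
        by (simp add: algebra_simps)
      also have "\<dots> = (\<integral>y. ?g y * (e / 2) \<partial>\<sigma>) + C * (\<integral>y. ?g y * (1 - x \<bullet> y) \<partial>\<sigma>)"
        by (subst Bochner_Integration.integral_add) (auto intro!: i integrable_mult_right continuous_intros)
      finally show ?thesis using g1[of k] g2 by simp
    qed
    also have "\<dots> < e" using k0[OF that] by simp
    finally show ?thesis .
  qed
  then show "\<exists>k0. \<forall>k\<ge>k0. norm ((\<integral>y. poly (peak k) (x \<bullet> y) * f y \<partial>\<sigma>) - f x) < e"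
    by blast
qed

text \<open>Take peaks for \<open>p\<close> in the previous formula. The interval factor is found by
  testing the same peaks against the zonal Legendre function, where the limit is its value 1 at
  \<open>x\<close>; against \<open>f\<close> the limit is \<open>f x\<close>.\<close>

lemma funk_hecke_legendre:
  assumes f: "sphere_eigenfunction l f" and x: "norm x = 1"
  shows "(\<integral>y. poly (legendre l) (x \<bullet> y) * f y \<partial>\<sigma>) = f x / (2 * real l + 1)"
proof -
  let ?P = "legendre l"
  let ?I = "\<integral>y. poly (legendre l) (x \<bullet> y) * f y \<partial>\<sigma>"
  have "(\<lambda>k. \<integral>y. poly (peak k) (x \<bullet> y) * poly ?P (x \<bullet> y) \<partial>\<sigma>) \<longlonglongrightarrow> poly ?P (x \<bullet> x)"
    by (rule tendsto_integral_peak[OF continuous_on_zonal x])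
  moreover have "(\<integral>y. poly (peak k) (x \<bullet> y) * poly ?P (x \<bullet> y) \<partial>\<sigma>) =
      integral {-1..1} (\<lambda>t. poly (peak k) t * poly ?P t) / 2" for k
  proof -
    have "poly (peak k * ?P) = (\<lambda>t. poly (peak k) t * poly ?P t)"
      by (simp add: fun_eq_iff)
    then show ?thesis
      using integral_zonal[OF x, of "peak k * ?P"] by simp
  qed
  ultimately have "(\<lambda>k. integral {-1..1} (\<lambda>t. poly (peak k) t * poly ?P t) / 2) \<longlonglongrightarrow> 1"
    using x by (simp add: norm_eq_1 poly_legendre_1)
  from tendsto_mult[OF tendsto_const[of "(2 * real l + 1) * ?I"] this]
  have "(\<lambda>k. \<integral>y. poly (peak k) (x \<bullet> y) * f y \<partial>\<sigma>) \<longlonglongrightarrow> (2 * real l + 1) * ?I"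
    unfolding integral_zonal_eigenfunction[OF f x, of "peak _"] by (simp add: mult_ac)
  moreover have "(\<lambda>k. \<integral>y. poly (peak k) (x \<bullet> y) * f y \<partial>\<sigma>) \<longlonglongrightarrow> f x"
    using f by (intro tendsto_integral_peak x continuous_on_real_polynomial_function) (simp add: sphere_eigenfunction_def)
  ultimately have "(2 * real l + 1) * ?I = f x"
    by (rule LIMSEQ_unique)
  then show ?thesis by (simp add: field_simps)
qed

text \<open>For polynomials the formula is already available. Both sides are Lipschitz in
  \<open>g\<close> for the uniform norm, so Weierstrass approximation extends it to continuous
  kernels.\<close>

lemma funk_hecke:
  assumes f: "sphere_eigenfunction l f" and x: "norm x = 1" and g: "continuous_on {-1..1} g"
  shows "(\<integral>y. g (x \<bullet> y) * f y \<partial>\<sigma>) = integral {-1..1} (\<lambda>t. g t * poly (legendre l) t) / 2 * f x"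
    (is "?L = ?R")
proof -
  let ?P = "legendre l"
  have cf: "continuous_on S f" for S
    using f by (intro continuous_on_real_polynomial_function) (simp add: sphere_eigenfunction_def)
  have "bounded (f ` sphere 0 1)"
    by (intro compact_imp_bounded compact_continuous_image cf) auto
  then obtain B where B: "\<And>y. norm y = 1 \<Longrightarrow> \<bar>f y\<bar> \<le> B"
    by (metis bounded_iff imageI mem_sphere_0 real_norm_def)
  have "bounded (poly ?P ` {-1..1})"
    by (intro compact_imp_bounded compact_continuous_image continuous_intros) auto
  then obtain B' where B': "\<And>t. t \<in> {-1..1} \<Longrightarrow> \<bar>poly ?P t\<bar> \<le> B'"
    by (metis bounded_iff imageI real_norm_def)
  have "\<bar>?L - ?R\<bar> \<le> e * (B + B' * \<bar>f x\<bar>)" if e: "e > 0" for e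
  proof -
    obtain p where p: "\<And>t. t \<in> {-1..1} \<Longrightarrow> \<bar>g t - poly p t\<bar> < e"
      using weierstrass_poly[OF g e] by blast
    have in1: "x \<bullet> y \<in> {-1..1}" if "norm y = 1" for y
      using abs_inner_le_1[OF x that] by auto
    have cg: "continuous_on (sphere 0 1) (\<lambda>y. g (x \<bullet> y))"
      by (intro continuous_on_compose2[OF g] continuous_intros) (use in1 in auto)
    have ip: "(\<integral>y. poly p (x \<bullet> y) * f y \<partial>\<sigma>) = integral {-1..1} (\<lambda>t. poly p t * poly ?P t) / 2 * f x"
    proof -
      define c where "c = 2 * real l + 1"
      have "c \<noteq> 0" by (simp add: c_def add_nonneg_eq_0_iff)
      then show ?thesis
        unfolding integral_zonal_eigenfunction[OF f x, of p] funk_hecke_legendre[OF f x] c_def [symmetric]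
        by simp
    qed
    have "\<bar>?L - (\<integral>y. poly p (x \<bullet> y) * f y \<partial>\<sigma>)\<bar> = norm (\<integral>y. (g (x \<bullet> y) - poly p (x \<bullet> y)) * f y \<partial>\<sigma>)"
      unfolding left_diff_distrib
      by (subst Bochner_Integration.integral_diff)
         (auto intro!: integrable_continuous_on_sphere continuous_intros cg cf continuous_on_zonal)
    also have "\<dots> \<le> (\<integral>y. norm ((g (x \<bullet> y) - poly p (x \<bullet> y)) * f y) \<partial>\<sigma>)"
      by (rule integral_norm_bound)
    also have "\<dots> \<le> (\<integral>y. e * B \<partial>\<sigma>)"
    proof (rule integral_mono)
      fix y assume "y \<in> space \<sigma>"
      then have y: "norm y = 1" by (simp add: space_eq)
      show "norm ((g (x \<bullet> y) - poly p (x \<bullet> y)) * f y) \<le> e * B"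
        using p[OF in1[OF y]] B[OF y] e unfolding real_norm_def abs_mult by (intro mult_mono) auto
    qed (auto intro!: integrable_continuous_on_sphere continuous_intros cg cf continuous_on_zonal)
    finally have 1: "\<bar>?L - (\<integral>y. poly p (x \<bullet> y) * f y \<partial>\<sigma>)\<bar> \<le> e * B"
      by (simp add: prob_space)
    let ?d = "integral {-1..1} (\<lambda>t. poly p t * poly ?P t) - integral {-1..1} (\<lambda>t. g t * poly ?P t)"
    have "?d = integral {-1..1} (\<lambda>t. (poly p t - g t) * poly ?P t)"
      unfolding left_diff_distrib
      by (intro integral_diff [symmetric] integrable_continuous_interval continuous_intros g)
    moreover have "norm (integral {-1..1} (\<lambda>t. (poly p t - g t) * poly ?P t)) \<le> (e * B') * (1 - (-1))"
    proof (rule integral_bound)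
      fix t :: real assume t: "t \<in> {-1..1}"
      show "norm ((poly p t - g t) * poly ?P t) \<le> e * B'"
        using p[OF t] B'[OF t] e unfolding real_norm_def abs_mult by (intro mult_mono) auto
    qed (auto intro!: continuous_intros g)
    ultimately have "\<bar>?d\<bar> / 2 \<le> e * B'" by simp
    then have "\<bar>?d\<bar> / 2 * \<bar>f x\<bar> \<le> e * B' * \<bar>f x\<bar>"
      by (rule mult_right_mono) simp
    moreover have "\<bar>(\<integral>y. poly p (x \<bullet> y) * f y \<partial>\<sigma>) - ?R\<bar> = \<bar>?d\<bar> / 2 * \<bar>f x\<bar>"
      unfolding ip by (simp add: abs_mult flip: left_diff_distrib diff_divide_distrib)
    ultimately have "\<bar>?L - ?R\<bar> \<le> e * B + e * B' * \<bar>f x\<bar>"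
      using 1 by linarith
    then show ?thesis by (simp add: algebra_simps)
  qed
  note bound = this
  have "\<bar>?L - ?R\<bar> \<le> 0 + e" if "e > 0" for e
  proof -
    define D where "D = B + B' * \<bar>f x\<bar>"
    have "D \<ge> 0"
      using B[OF x] B'[of 0] by (auto simp: D_def)
    \<comment> \<open>Dividing by \<open>D + 1\<close> in place of \<open>D\<close> also covers
      \<open>D = 0\<close>.\<close>
    then have "e / (D + 1) * D \<le> e"
      using that by (simp add: field_simps)
    then show ?thesis
      using bound[of "e / (D + 1)"] that \<open>D \<ge> 0\<close> by (simp add: D_def)
  qed
  then have "\<bar>?L - ?R\<bar> \<le> 0" by (rule field_le_epsilon)
  then show ?thesis by simp
qed

end

section \<open>The addition theorem\<close>

lemma DERIV_partial:
  assumes "real_polynomial_function f"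
  shows "((\<lambda>t. f (x + t *\<^sub>R axis i 1)) has_real_derivative partial i f (x + t *\<^sub>R axis i 1)) (at t)"
proof -
  have "((\<lambda>t. x + t *\<^sub>R axis i 1) has_derivative (\<lambda>h. h *\<^sub>R axis i 1)) (at t)"
    by (auto intro!: derivative_eq_intros)
  from has_derivative_compose[OF this real_polynomial_function_has_derivative[OF assms]]
  have "((\<lambda>t. f (x + t *\<^sub>R axis i 1)) has_derivative
    (\<lambda>h. \<Sum>k\<in>UNIV. (h *\<^sub>R axis i 1) $ k * partial k f (x + t *\<^sub>R axis i 1))) (at t)" .
  moreover have "(\<lambda>h. \<Sum>k\<in>UNIV. (h *\<^sub>R axis i 1) $ k * partial k f (x + t *\<^sub>R axis i 1)) =
      (*) (partial i f (x + t *\<^sub>R axis i 1))"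
  proof -
    have "(h *\<^sub>R axis i 1) $ k = (if k = i then h else 0)" for h and k :: 'a
      by (simp add: axis_def)
    then show ?thesis
      by (simp add: fun_eq_iff if_distrib[where f = "\<lambda>x. x * _"] mult.commute del: vector_scaleR_component cong: if_cong)
  qed
  ultimately show ?thesis by (simp add: has_field_derivative_def)
qed

text \<open>The formula is needed at every \<open>t\<close>: the outer derivative in
  \<open>laplacian\<close> differentiates the inner one as a function of its parameter.\<close>

lemma vector_derivative_complex_partial:
  assumes "real_polynomial_function u" "real_polynomial_function v"
  shows "vector_derivative (\<lambda>t. Complex (u (x + t *\<^sub>R axis i 1)) (v (x + t *\<^sub>R axis i 1))) (at t) =
    Complex (partial i u (x + t *\<^sub>R axis i 1)) (partial i v (x + t *\<^sub>R axis i 1))"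
  using assms[THEN DERIV_partial, of x i t]
  by (intro vector_derivative_at)
     (auto simp: Complex_eq has_real_derivative_iff_has_vector_derivative
       intro!: has_vector_derivative_add has_vector_derivative_mult_right has_vector_derivative_of_real)

text \<open>The Laplacian and the factor \<open>r ^ l\<close> are real, so the real and imaginary
  parts of a harmonic homogeneous polynomial are themselves harmonic and homogeneous.\<close>

lemma spherical_harmonic_Complex:
  assumes "spherical_harmonic l Y"
  obtains u v where "sphere_eigenfunction l u" "sphere_eigenfunction l v"
    "\<And>x. norm x = 1 \<Longrightarrow> Y x = Complex (u x) (v x)"
proof -
  obtain h where h: "polynomial_function h" "\<And>r x. h (r *\<^sub>R x) = of_real (r ^ l) * h x"
      "\<And>x. laplacian h x = 0" "\<And>x. norm x = 1 \<Longrightarrow> Y x = h x"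
    using assms unfolding spherical_harmonic_def by auto
  define u v where "u = Re \<circ> h" and "v = Im \<circ> h"
  have hC: "h = (\<lambda>x. Complex (u x) (v x))"
    by (simp add: u_def v_def)
  have p: "real_polynomial_function u" "real_polynomial_function v"
    using h(1) bounded_linear_Re bounded_linear_Im unfolding polynomial_function_def u_def v_def by blast+
  have "laplacian h x = Complex (\<Sum>i\<in>UNIV. partial i (partial i u) x) (\<Sum>i\<in>UNIV. partial i (partial i v) x)" for x
    unfolding hC laplacian_def vector_derivative_complex_partial[OF p]
      vector_derivative_complex_partial[OF p[THEN real_polynomial_function_partial]]
    by (simp add: complex_eq_iff)
  then have harm: "(\<Sum>i\<in>UNIV. partial i (partial i u) x) = 0" "(\<Sum>i\<in>UNIV. partial i (partial i v) x) = 0" for x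
    using h(3)[of x] by (simp_all add: complex_eq_iff)
  have "u (r *\<^sub>R x) = r ^ l * u x" "v (r *\<^sub>R x) = r ^ l * v x" for r x
    by (simp_all add: u_def v_def h(2) flip: of_real_power)
  then have "sphere_eigenfunction l u" "sphere_eigenfunction l v"
    using p harm by (auto intro: sphere_eigenfunction_homogeneous)
  then show ?thesis
    using that h(4) hC by metis
qed

text \<open>Homogeneity holds for negative scalars too; \<open>r = -1\<close> gives the
  parity.\<close>

lemma spherical_harmonic_uminus:
  assumes "spherical_harmonic l Y" "norm x = 1"
  shows "Y (- x) = (- 1) ^ l * Y x"
proof -
  obtain h where h: "\<forall>r x. h (r *\<^sub>R x) = of_real (r ^ l) * h x" "\<forall>x\<in>sphere 0 1. Y x = h x"
    using assms(1) unfolding spherical_harmonic_def by blast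
  show ?thesis
    using h(1)[rule_format, of "-1" x] h(2) assms(2) by simp
qed

lemma continuous_on_spherical_harmonic:
  assumes "spherical_harmonic l Y"
  shows "continuous_on (sphere 0 1) Y"
proof -
  obtain h where h: "polynomial_function h" "\<And>x. x \<in> sphere 0 1 \<Longrightarrow> Y x = h x"
    using assms unfolding spherical_harmonic_def by auto
  then show ?thesis
    using continuous_on_polymonial_function[OF h(1)] by (subst continuous_on_cong[OF refl h(2)])
qed

context uniform_sphere
begin

text \<open>Vanishing almost everywhere becomes vanishing at each point through the peaks: their
  integrals against \<open>f\<close> are all zero and converge to \<open>f x\<close>.\<close>

lemma continuous_nonneg_integral_zero:
  fixes f :: "real^3 \<Rightarrow> real"
  assumes f: "continuous_on (sphere 0 1) f" and nonneg: "\<And>y. norm y = 1 \<Longrightarrow> f y \<ge> 0"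
    and int: "(\<integral>y. f y \<partial>\<sigma>) = 0" and x: "norm x = 1"
  shows "f x = 0"
proof -
  have "AE y in \<sigma>. f y \<ge> 0"
    using nonneg by (intro AE_I2) (simp add: space_eq)
  then have "AE y in \<sigma>. f y = 0"
    using int integral_nonneg_eq_0_iff_AE[OF integrable_continuous_on_sphere[OF f]] by simp
  then have "(\<integral>y. poly (peak k) (x \<bullet> y) * f y \<partial>\<sigma>) = 0" for k
    by (intro integral_eq_zero_AE) auto
  then show ?thesis
    using tendsto_integral_peak[OF f x] by (simp add: LIMSEQ_const_iff)
qed

lemma integral_legendre_spherical_harmonic:
  assumes Y: "spherical_harmonic l Y" and x: "norm x = 1"
  shows "(\<integral>y. of_real (poly (legendre l) (x \<bullet> y)) * Y y \<partial>\<sigma>) = Y x / of_nat (2 * l + 1)"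
proof -
  obtain u v where uv: "sphere_eigenfunction l u" "sphere_eigenfunction l v"
      and Yuv: "\<And>x. norm x = 1 \<Longrightarrow> Y x = Complex (u x) (v x)"
    using spherical_harmonic_Complex[OF Y] by blast
  let ?P = "\<lambda>y. poly (legendre l) (x \<bullet> y)"
  have i: "integrable \<sigma> (\<lambda>y. ?P y * f y)" if "sphere_eigenfunction l f" for f
    using that by (intro integrable_poly_function real_polynomial_function.intros(4) real_polynomial_function_zonal)
      (simp add: sphere_eigenfunction_def)
  have "(\<integral>y. of_real (?P y) * Y y \<partial>\<sigma>) = (\<integral>y. complex_of_real (?P y * u y) + \<i> * complex_of_real (?P y * v y) \<partial>\<sigma>)"
    by (intro Bochner_Integration.integral_cong) (auto simp: space_eq Yuv complex_eq_iff)
  also have "\<dots> = complex_of_real (\<integral>y. ?P y * u y \<partial>\<sigma>) + \<i> * complex_of_real (\<integral>y. ?P y * v y \<partial>\<sigma>)"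
    using i[OF uv(1)] i[OF uv(2)]
    by (subst Bochner_Integration.integral_add) (auto simp del: of_real_mult)
  also have "\<dots> = Complex (u x) (v x) / of_nat (2 * l + 1)"
    unfolding funk_hecke_legendre[OF uv(1) x] funk_hecke_legendre[OF uv(2) x]
    by (simp add: Complex_eq add_divide_distrib add.commute)
  finally show ?thesis by (simp add: Yuv x)
qed

lemma addition_theorem:
  assumes Y: "orthonormal_spherical_harmonics \<sigma> Y" and x: "norm x = 1" and y: "norm y = 1"
  shows "(\<Sum>m=- int l..int l. Y l m x * cnj (Y l m y)) = of_real (real (2 * l + 1) * poly (legendre l) (x \<bullet> y))"
proof -
  let ?S = "{- int l..int l}" and ?d = "real (2 * l + 1)"
  let ?P = "\<lambda>x y. poly (legendre l) (x \<bullet> y)"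
  define K where "K x y = complex_of_real (?d * ?P x y) - (\<Sum>m\<in>?S. Y l m x * cnj (Y l m y))" for x y
  have sh: "spherical_harmonic l (Y l m)" if "m \<in> ?S" for m
    using Y that by (simp add: orthonormal_spherical_harmonics_def)
  have orth: "(\<integral>y. Y l m y * cnj (Y l m' y) \<partial>\<sigma>) = (if m = m' then 1 else 0)" if "m \<in> ?S" "m' \<in> ?S" for m m'
    using Y that by (simp add: orthonormal_spherical_harmonics_def)
  note cY = continuous_on_spherical_harmonic[OF sh]
  have cP: "continuous_on S (\<lambda>y. ?P x y)" for S x
    by (rule continuous_on_zonal)
  have cK: "continuous_on (sphere 0 1) (K x)" for x
    unfolding K_def by (intro continuous_intros cP cY)
  have cnj_sum_norm: "(\<Sum>m\<in>?S. Y l m x * cnj (Y l m x)) = of_real (\<Sum>m\<in>?S. (cmod (Y l m x))\<^sup>2)" for x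
    by (simp only: of_real_sum complex_norm_square)
  \<comment> \<open>Expanding the square gives four integrals. The square of the Legendre term
    yields \<open>?d\<close>; both cross terms and the square of the harmonic sum yield the same sum
    of squared moduli, so one negative copy of it remains.\<close>
  have D: "(\<integral>y. (cmod (K x y))\<^sup>2 \<partial>\<sigma>) = ?d - (\<Sum>m\<in>?S. (cmod (Y l m x))\<^sup>2)" if x: "norm x = 1" for x
  proof -
    let ?F = "\<lambda>y. \<Sum>m\<in>?S. Y l m x * cnj (Y l m y)"
    let ?A = "\<lambda>y. complex_of_real (?P x y)"
    have PY: "(\<integral>y. ?A y * Y l m y \<partial>\<sigma>) = Y l m x / of_real ?d" if "m \<in> ?S" for m
      using integral_legendre_spherical_harmonic[OF sh[OF that] x] by simp
    have PY': "(\<integral>y. ?A y * cnj (Y l m y) \<partial>\<sigma>) = cnj (Y l m x) / of_real ?d" if "m \<in> ?S" for m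
    proof -
      have "(\<integral>y. ?A y * cnj (Y l m y) \<partial>\<sigma>) = (\<integral>y. cnj (?A y * Y l m y) \<partial>\<sigma>)"
        by (simp only: complex_cnj_mult complex_cnj_complex_of_real)
      also have "\<dots> = cnj (\<integral>y. ?A y * Y l m y \<partial>\<sigma>)"
        by (rule Bochner_Integration.integral_cnj)
      finally show ?thesis
        unfolding PY[OF that] by simp
    qed
    \<comment> \<open>Funk-Hecke with the zonal Legendre function itself as eigenfunction, evaluated
      at its pole.\<close>
    have PP: "(\<integral>y. ?A y * ?A y \<partial>\<sigma>) = 1 / of_real ?d"
      using funk_hecke_legendre[OF sphere_eigenfunction_legendre[OF x, of l] x] x
      by (simp add: norm_eq_1 poly_legendre_1 add.commute flip: of_real_mult)
    note ci = integrable_continuous_on_sphere continuous_intros cP cY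
    have AF: "(\<integral>y. ?A y * ?F y \<partial>\<sigma>) = (\<Sum>m\<in>?S. Y l m x * cnj (Y l m x)) / of_real ?d"
    proof -
      have "(\<integral>y. ?A y * ?F y \<partial>\<sigma>) = (\<Sum>m\<in>?S. \<integral>y. Y l m x * (?A y * cnj (Y l m y)) \<partial>\<sigma>)"
        by (subst Bochner_Integration.integral_sum [symmetric]) (auto intro!: ci simp: sum_distrib_left mult_ac)
      then show ?thesis
        by (simp add: PY' sum_divide_distrib)
    qed
    have AF': "(\<integral>y. ?A y * cnj (?F y) \<partial>\<sigma>) = (\<Sum>m\<in>?S. Y l m x * cnj (Y l m x)) / of_real ?d"
    proof -
      have "(\<integral>y. ?A y * cnj (?F y) \<partial>\<sigma>) = cnj (\<integral>y. ?A y * ?F y \<partial>\<sigma>)"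
        by (subst Bochner_Integration.integral_cnj [symmetric]) simp
      then show ?thesis
        unfolding AF by (simp add: mult.commute)
    qed
    have FF: "(\<integral>y. ?F y * cnj (?F y) \<partial>\<sigma>) = (\<Sum>m\<in>?S. Y l m x * cnj (Y l m x))"
    proof -
      have "(\<integral>y. ?F y * cnj (?F y) \<partial>\<sigma>) =
          (\<integral>y. (\<Sum>m\<in>?S. \<Sum>m'\<in>?S. (Y l m x * cnj (Y l m' x)) * (Y l m' y * cnj (Y l m y))) \<partial>\<sigma>)"
        unfolding cnj_sum sum_product by (simp add: mult_ac)
      also have "\<dots> = (\<Sum>m\<in>?S. \<integral>y. (\<Sum>m'\<in>?S. (Y l m x * cnj (Y l m' x)) * (Y l m' y * cnj (Y l m y))) \<partial>\<sigma>)"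
        by (intro Bochner_Integration.integral_sum ci)
      also have "\<dots> = (\<Sum>m\<in>?S. \<Sum>m'\<in>?S. \<integral>y. (Y l m x * cnj (Y l m' x)) * (Y l m' y * cnj (Y l m y)) \<partial>\<sigma>)"
        by (intro sum.cong refl Bochner_Integration.integral_sum ci)
      also have "\<dots> = (\<Sum>m\<in>?S. \<Sum>m'\<in>?S. (Y l m x * cnj (Y l m' x)) * (\<integral>y. Y l m' y * cnj (Y l m y) \<partial>\<sigma>))"
        by (simp only: integral_mult_right_zero)
      also have "\<dots> = (\<Sum>m\<in>?S. \<Sum>m'\<in>?S. if m' = m then Y l m x * cnj (Y l m x) else 0)"
        by (intro sum.cong refl) (simp add: orth)
      finally show ?thesis by simp
    qed
    have "complex_of_real (\<integral>y. (cmod (K x y))\<^sup>2 \<partial>\<sigma>) = (\<integral>y. K x y * cnj (K x y) \<partial>\<sigma>)"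
      by (simp only: complex_norm_square [symmetric] integral_complex_of_real)
    also have "\<dots> = (\<integral>y. of_real (?d\<^sup>2) * (?A y * ?A y) - of_real ?d * (?A y * ?F y) -
        of_real ?d * (?A y * cnj (?F y)) + ?F y * cnj (?F y) \<partial>\<sigma>)"
      unfolding K_def by (intro Bochner_Integration.integral_cong refl)
        (simp only: complex_cnj_diff complex_cnj_complex_of_real, simp add: algebra_simps power2_eq_square)
    also have "\<dots> = of_real (?d\<^sup>2) * (\<integral>y. ?A y * ?A y \<partial>\<sigma>) - of_real ?d * (\<integral>y. ?A y * ?F y \<partial>\<sigma>) -
        of_real ?d * (\<integral>y. ?A y * cnj (?F y) \<partial>\<sigma>) + (\<integral>y. ?F y * cnj (?F y) \<partial>\<sigma>)"
    proof -
      have "integrable \<sigma> (\<lambda>y. of_real (?d\<^sup>2) * (?A y * ?A y))" "integrable \<sigma> (\<lambda>y. of_real ?d * (?A y * ?F y))"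
          "integrable \<sigma> (\<lambda>y. of_real ?d * (?A y * cnj (?F y)))" "integrable \<sigma> (\<lambda>y. ?F y * cnj (?F y))"
        by (intro ci; assumption?)+
      then show ?thesis
        by (simp only: Bochner_Integration.integral_add Bochner_Integration.integral_diff Bochner_Integration.integrable_diff integral_mult_right_zero)
    qed
    also have "\<dots> = of_real (?d - (\<Sum>m\<in>?S. (cmod (Y l m x))\<^sup>2))"
    proof -
      have "?d \<noteq> 0" by simp
      then show ?thesis
        unfolding AF AF' FF PP cnj_sum_norm
        by (simp add: power2_eq_square del: of_nat_Suc of_nat_add of_nat_mult)
    qed
    finally show ?thesis by (simp only: of_real_eq_iff)
  qed
  \<comment> \<open>By \<open>D\<close> the difference is the integral of a square, hence
    nonnegative. Its own integral is \<open>2 * l + 1\<close> minus the number of orthonormal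
    functions, which is zero.\<close>
  have trace: "?d - (\<Sum>m\<in>?S. (cmod (Y l m x))\<^sup>2) = 0" if x: "norm x = 1" for x
  proof (rule continuous_nonneg_integral_zero[OF _ _ _ x])
    show "continuous_on (sphere 0 1) (\<lambda>x. ?d - (\<Sum>m\<in>?S. (cmod (Y l m x))\<^sup>2))"
      by (intro continuous_intros cY)
    show "?d - (\<Sum>m\<in>?S. (cmod (Y l m y))\<^sup>2) \<ge> 0" if "norm y = 1" for y
      unfolding D[OF that, symmetric] by simp
    have "complex_of_real (\<integral>y. (cmod (Y l m y))\<^sup>2 \<partial>\<sigma>) = 1" if "m \<in> ?S" for m
      using orth[OF that that] by (simp only: complex_norm_square [symmetric] integral_complex_of_real simp_thms if_True)
    then have 1: "(\<integral>y. (cmod (Y l m y))\<^sup>2 \<partial>\<sigma>) = 1" if "m \<in> ?S" for m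
      using that by (metis of_real_eq_1_iff)
    have i: "integrable \<sigma> (\<lambda>y. (cmod (Y l m y))\<^sup>2)" if "m \<in> ?S" for m
      by (intro integrable_continuous_on_sphere continuous_intros cY that)
    have "(\<integral>y. ?d - (\<Sum>m\<in>?S. (cmod (Y l m y))\<^sup>2) \<partial>\<sigma>) =
        (\<integral>y. ?d \<partial>\<sigma>) - (\<integral>y. (\<Sum>m\<in>?S. (cmod (Y l m y))\<^sup>2) \<partial>\<sigma>)"
      by (intro Bochner_Integration.integral_diff Bochner_Integration.integrable_sum i integrable_const)
    also have "(\<integral>y. (\<Sum>m\<in>?S. (cmod (Y l m y))\<^sup>2) \<partial>\<sigma>) = (\<Sum>m\<in>?S. \<integral>y. (cmod (Y l m y))\<^sup>2 \<partial>\<sigma>)"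
      by (intro Bochner_Integration.integral_sum i)
    also have "\<dots> = (\<Sum>m\<in>?S. 1)"
      by (intro sum.cong refl 1)
    finally show "(\<integral>y. ?d - (\<Sum>m\<in>?S. (cmod (Y l m y))\<^sup>2) \<partial>\<sigma>) = 0"
      by (simp add: prob_space)
  qed
  have "(cmod (K x y))\<^sup>2 = 0"
  proof (rule continuous_nonneg_integral_zero[OF _ _ _ y, of "\<lambda>y. (cmod (K x y))\<^sup>2"])
    show "continuous_on (sphere 0 1) (\<lambda>y. (cmod (K x y))\<^sup>2)"
      by (intro continuous_intros cK)
    show "(\<integral>y. (cmod (K x y))\<^sup>2 \<partial>\<sigma>) = 0"
      unfolding D[OF x] by (rule trace[OF x])
  qed simp
  then show ?thesis by (simp add: K_def)
qed

end

section \<open>The cosine transform of a discrete measure\<close>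

text \<open>The measure is the image of a weighted finite set with two points for each
  \<open>p\<close>, the boolean choosing between \<open>n p\<close> and its antipode. Integration
  over a finite point measure is a finite sum.\<close>

lemma integral_symmetrized_measure:
  fixes f :: "real^3 \<Rightarrow> 'b::{second_countable_topology, banach}"
  assumes n: "\<And>p. p \<in> {1..N} \<Longrightarrow> n p \<in> sphere 0 1" and c: "\<And>p. p \<in> {1..N} \<Longrightarrow> c p > 0"
    and f: "f \<in> borel_measurable sphere_borel"
  shows "(\<integral>x. f x \<partial>symmetrized_measure N c n) = (\<Sum>p=1..N. (c p / 2) *\<^sub>R (f (n p) + f (- n p)))"
proof -
  define I where "I = {1..N} \<times> (UNIV :: bool set)"
  define w where "w = (\<lambda>(p, b :: bool). c p / 2)"
  define pt where "pt = (\<lambda>(p, b). if b then n p else - n p)"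
  have fin: "finite I" by (simp add: I_def)
  have w: "w a \<ge> 0" if "a \<in> I" for a
    using c that by (auto simp: I_def w_def less_imp_le)
  have pt: "pt \<in> measurable (point_measure I w) sphere_borel"
    using n by (auto simp: measurable_point_measure_eq1 space_sphere_borel I_def pt_def)
  have sumI: "(\<Sum>a\<in>I. g a) = (\<Sum>p=1..N. g (p, True) + g (p, False))" for g :: "nat \<times> bool \<Rightarrow> 'c::comm_monoid_add"
    using sum.cartesian_product[of "\<lambda>p b. g (p, b)" UNIV "{1..N}"]
    by (simp add: I_def UNIV_bool add.commute)
  have "symmetrized_measure N c n = distr (point_measure I w) sphere_borel pt"
  proof (rule measure_eqI)
    fix A assume "A \<in> sets (symmetrized_measure N c n)"
    then have A: "A \<in> sets sphere_borel" by simp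
    have "emeasure (distr (point_measure I w) sphere_borel pt) A = (\<Sum>a | a \<in> I \<and> pt a \<in> A. ennreal (w a))"
      using A pt fin by (simp add: emeasure_distr space_point_measure emeasure_point_measure_finite vimage_def Int_def conj_commute)
    also have "\<dots> = (\<Sum>a\<in>I. ennreal (w a) * indicator A (pt a))"
      using fin by (intro sum.mono_neutral_cong_left) (auto simp: indicator_def)
    also have "\<dots> = (\<Sum>p=1..N. ennreal (c p / 2) * (indicator A (n p) + indicator A (- n p)))"
      by (simp add: sumI w_def pt_def distrib_left)
    also have "\<dots> = emeasure (symmetrized_measure N c n) A"
      unfolding emeasure_symmetrized_measure[OF A] sum_distrib_left
    proof (intro sum.cong refl)
      fix p assume "p \<in> {1..N}"
      have "ennreal (c p / 2) = ennreal (1 / 2) * ennreal (c p)"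
        using c[OF \<open>p \<in> {1..N}\<close>] by (subst ennreal_mult [symmetric]) auto
      then show "ennreal (c p / 2) * (indicator A (n p) + indicator A (- n p)) =
          ennreal (1 / 2) * (ennreal (c p) * (indicator A (n p) + indicator A (- n p)))"
        by (simp add: mult.assoc)
    qed
    finally show "emeasure (symmetrized_measure N c n) A = emeasure (distr (point_measure I w) sphere_borel pt) A"
      by simp
  qed simp
  then have "(\<integral>x. f x \<partial>symmetrized_measure N c n) = (\<integral>a. f (pt a) \<partial>point_measure I w)"
    using pt f by (simp add: integral_distr)
  also have "\<dots> = (\<Sum>a\<in>I. w a *\<^sub>R f (pt a))"
    using fin w by (rule lebesgue_integral_point_measure_finite)
  finally show ?thesis
    by (simp add: sumI w_def pt_def scaleR_add_right)
qed

context uniform_sphere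
begin

lemma integral_legendre_legendre:
  assumes "norm x = 1" "norm z = 1"
  shows "(\<integral>y. poly (legendre j) (x \<bullet> y) * poly (legendre l) (z \<bullet> y) \<partial>\<sigma>) =
    (if j = l then poly (legendre l) (z \<bullet> x) / (2 * real l + 1) else 0)"
  using integral_legendre_eigenfunction[OF sphere_eigenfunction_legendre[OF assms(2)] assms(1), of j l]
    funk_hecke_legendre[OF sphere_eigenfunction_legendre[OF assms(2)] assms(1), of l]
  by simp

lemma integral_abs_legendre:
  assumes "norm x = 1" "norm z = 1"
  shows "(\<integral>y. \<bar>x \<bullet> y\<bar> * poly (legendre l) (z \<bullet> y) \<partial>\<sigma>) = abs_legendre_coeff l * poly (legendre l) (z \<bullet> x)"
  using funk_hecke[OF sphere_eigenfunction_legendre[OF assms(2)] assms(1), of abs l]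
  by (simp add: abs_legendre_coeff_def continuous_on_rabs[OF continuous_on_id])

text \<open>Replacing \<open>x\<close> by \<open>- x\<close> in the absolute value changes nothing
  on the left, but turns the value of the Legendre polynomial at 1 into that at -1, which is -1 for
  odd degree.\<close>

lemma abs_legendre_coeff_odd:
  assumes "odd l"
  shows "abs_legendre_coeff l = 0"
proof -
  define x :: "real^3" where "x = axis 1 1"
  have x: "norm x = 1" "norm (- x) = 1"
    by (simp_all add: x_def)
  show ?thesis
    using integral_abs_legendre[OF x(1) x(1), of l] integral_abs_legendre[OF x(2) x(1), of l] assms x(1)
    by (simp add: norm_eq_1 poly_legendre_1 poly_legendre_neg_1)
qed

text \<open>The zonal sums \<open>h l\<close> are orthogonal, with squared norm \<open>Q l\<close>
  over \<open>2 l + 1\<close>; in particular \<open>Q l\<close> is nonnegative. By Funk-Hecke the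
  component of \<open>X\<close> in degree \<open>l\<close> is
  \<open>(2 l + 1) * abs_legendre_coeff l\<close> times \<open>h l\<close>, so the series sums the
  squared norms of these components.\<close>

lemma cosine_transform_parseval:
  fixes n :: "nat \<Rightarrow> real^3" and c :: "nat \<Rightarrow> real"
  assumes n: "\<And>p. p \<in> A \<Longrightarrow> norm (n p) = 1" and c: "\<And>p. p \<in> A \<Longrightarrow> c p \<ge> 0" and A: "finite A"
  defines "Q \<equiv> \<lambda>l. \<Sum>p\<in>A. \<Sum>q\<in>A. c p * c q * poly (legendre l) (n p \<bullet> n q)"
  shows "(\<lambda>l. (2 * real l + 1) * (abs_legendre_coeff l)\<^sup>2 * Q l) sums (\<integral>u. (\<Sum>p\<in>A. c p * \<bar>n p \<bullet> u\<bar>)\<^sup>2 \<partial>\<sigma>)"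
    and "\<And>l. Q l \<ge> 0"
proof -
  define X where "X u = (\<Sum>p\<in>A. c p * \<bar>n p \<bullet> u\<bar>)" for u
  define h where "h l u = (\<Sum>q\<in>A. c q * poly (legendre l) (n q \<bullet> u))" for l u
  let ?a = abs_legendre_coeff and ?d = "\<lambda>l. 2 * real l + 1"
  let ?V = "\<integral>u. (X u)\<^sup>2 \<partial>\<sigma>" and ?S = "\<lambda>K. \<Sum>l<K. ?d l * (?a l)\<^sup>2 * Q l"
  have d: "?d l > 0" for l by simp
  have cX: "continuous_on S X" and ch: "continuous_on S (h l)" for S l
    unfolding X_def h_def by (intro continuous_intros continuous_on_zonal)+
  note ci = integrable_continuous_on_sphere continuous_intros cX ch continuous_on_zonal
  have comm: "n q \<bullet> n p = n p \<bullet> n q" for p q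
    by (rule inner_commute)
  have hh: "(\<integral>u. h j u * h l u \<partial>\<sigma>) = (if j = l then Q l / ?d l else 0)" for j l
  proof -
    have "(\<integral>u. h j u * h l u \<partial>\<sigma>) =
        (\<integral>u. (\<Sum>p\<in>A. \<Sum>q\<in>A. (c p * c q) * (poly (legendre j) (n p \<bullet> u) * poly (legendre l) (n q \<bullet> u))) \<partial>\<sigma>)"
      unfolding h_def by (simp add: sum_product mult_ac)
    also have "\<dots> = (\<Sum>p\<in>A. \<Sum>q\<in>A. (c p * c q) * (\<integral>u. poly (legendre j) (n p \<bullet> u) * poly (legendre l) (n q \<bullet> u) \<partial>\<sigma>))"
      by (simp add: Bochner_Integration.integral_sum ci)
    also have "\<dots> = (if j = l then Q l / ?d l else 0)"
      by (simp add: comm integral_legendre_legendre n Q_def sum_divide_distrib)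
    finally show ?thesis .
  qed
  have Xh: "(\<integral>u. X u * h l u \<partial>\<sigma>) = ?a l * Q l" for l
  proof -
    have "(\<integral>u. X u * h l u \<partial>\<sigma>) =
        (\<integral>u. (\<Sum>p\<in>A. \<Sum>q\<in>A. (c p * c q) * (\<bar>n p \<bullet> u\<bar> * poly (legendre l) (n q \<bullet> u))) \<partial>\<sigma>)"
      unfolding X_def h_def by (simp add: sum_product mult_ac)
    also have "\<dots> = (\<Sum>p\<in>A. \<Sum>q\<in>A. (c p * c q) * (\<integral>u. \<bar>n p \<bullet> u\<bar> * poly (legendre l) (n q \<bullet> u) \<partial>\<sigma>))"
      by (simp add: Bochner_Integration.integral_sum ci)
    also have "\<dots> = ?a l * Q l"
      by (simp add: comm integral_abs_legendre n Q_def sum_distrib_left mult_ac)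
    finally show ?thesis .
  qed
  show Q: "Q l \<ge> 0" for l
  proof -
    have "Q l / ?d l \<ge> 0"
      using hh[of l l] Bochner_Integration.integral_nonneg[of \<sigma> "\<lambda>u. h l u * h l u"] by simp
    then show ?thesis
      using d[of l] by (simp add: zero_le_divide_iff)
  qed
  \<comment> \<open>Pythagoras for arbitrary coefficients \<open>b\<close>. The optimal choice gives
    Bessel's inequality, and the coefficients of an approximating polynomial give the reverse
    bound.\<close>
  have dist: "(\<integral>u. (X u - (\<Sum>l<K. b l * h l u))\<^sup>2 \<partial>\<sigma>) = ?V - ?S K + (\<Sum>l<K. Q l / ?d l * (b l - ?d l * ?a l)\<^sup>2)" for K b
  proof -
    have "(\<integral>u. (X u - (\<Sum>l<K. b l * h l u))\<^sup>2 \<partial>\<sigma>) =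
        (\<integral>u. (X u)\<^sup>2 - (\<Sum>l<K. 2 * b l * (X u * h l u)) + (\<Sum>j<K. \<Sum>l<K. (b j * b l) * (h j u * h l u)) \<partial>\<sigma>)"
    proof (intro Bochner_Integration.integral_cong refl)
      fix u
      have "2 * X u * (\<Sum>l<K. b l * h l u) = (\<Sum>l<K. 2 * b l * (X u * h l u))"
        by (simp add: sum_distrib_left mult_ac)
      moreover have "(\<Sum>l<K. b l * h l u)\<^sup>2 = (\<Sum>j<K. \<Sum>l<K. (b j * b l) * (h j u * h l u))"
        unfolding power2_eq_square sum_product by (simp add: mult_ac)
      ultimately show "(X u - (\<Sum>l<K. b l * h l u))\<^sup>2 =
          (X u)\<^sup>2 - (\<Sum>l<K. 2 * b l * (X u * h l u)) + (\<Sum>j<K. \<Sum>l<K. (b j * b l) * (h j u * h l u))"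
        by (simp add: power2_diff)
    qed
    also have "\<dots> = ?V - (\<Sum>l<K. 2 * b l * (\<integral>u. X u * h l u \<partial>\<sigma>)) +
        (\<Sum>j<K. \<Sum>l<K. (b j * b l) * (\<integral>u. h j u * h l u \<partial>\<sigma>))"
      by (simp add: Bochner_Integration.integral_sum ci)
    also have "\<dots> = ?V - (\<Sum>l<K. 2 * b l * (?a l * Q l)) + (\<Sum>j<K. \<Sum>l<K. if j = l then b l * b l * (Q l / ?d l) else 0)"
      unfolding Xh hh by (simp add: if_distrib cong: if_cong)
    also have "\<dots> = ?V + (\<Sum>l<K. b l * b l * (Q l / ?d l) - 2 * b l * (?a l * Q l))"
      by (simp add: sum_subtractf)
    \<comment> \<open>Completing the square with the weight factored out avoids division by
      \<open>Q l\<close>, which may be zero.\<close>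
    also have "(\<Sum>l<K. b l * b l * (Q l / ?d l) - 2 * b l * (?a l * Q l)) =
        (\<Sum>l<K. Q l / ?d l * (b l - ?d l * ?a l)\<^sup>2 - ?d l * (?a l)\<^sup>2 * Q l)"
    proof (intro sum.cong refl)
      fix l
      define D where "D = ?d l"
      have "D \<noteq> 0" using d[of l] by (simp add: D_def)
      then show "b l * b l * (Q l / ?d l) - 2 * b l * (?a l * Q l) = Q l / ?d l * (b l - ?d l * ?a l)\<^sup>2 - ?d l * (?a l)\<^sup>2 * Q l"
        unfolding D_def [symmetric] by (simp add: field_simps power2_eq_square)
    qed
    finally show ?thesis by (simp add: sum_subtractf)
  qed
  have upper: "?S K \<le> ?V" for K
    using dist[of "\<lambda>l. ?d l * ?a l" K] Bochner_Integration.integral_nonneg[of \<sigma> "\<lambda>u. (X u - (\<Sum>l<K. ?d l * ?a l * h l u))\<^sup>2"]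
    by simp
  \<comment> \<open>If \<open>g\<close> is within \<open>e\<close> of the absolute value, the zonal
    sum formed with \<open>g\<close> is within \<open>e\<close> times the total weight of
    \<open>X\<close>. It is a combination of the \<open>h l\<close>, and by \<open>dist\<close> the
    optimal combination is at least as close.\<close>
  have lower: "\<exists>K. ?V - ?S K \<le> (e * (\<Sum>p\<in>A. c p))\<^sup>2" if e: "e > 0" for e
  proof -
    have "continuous_on {-1..1} (abs :: real \<Rightarrow> real)"
      by (intro continuous_intros)
    then obtain g where g: "\<And>t. t \<in> {-1..1} \<Longrightarrow> \<bar>\<bar>t\<bar> - poly g t\<bar> < e"
      using weierstrass_poly[OF _ e] by blast
    obtain b where b: "g = (\<Sum>l<Suc (degree g). smult (b l) (legendre l))"
      using poly_legendre_expansion[of g "Suc (degree g)"] by blast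
    let ?K = "Suc (degree g)"
    have gh: "(\<Sum>l<?K. b l * h l u) = (\<Sum>p\<in>A. c p * poly g (n p \<bullet> u))" for u
    proof -
      have "poly g t = (\<Sum>l<?K. b l * poly (legendre l) t)" for t
        by (subst b) (simp add: poly_sum del: sum.lessThan_Suc)
      then show ?thesis
        unfolding h_def by (simp add: sum_distrib_left mult_ac sum.swap[of _ A] del: sum.lessThan_Suc)
    qed
    have "(X u - (\<Sum>l<?K. b l * h l u))\<^sup>2 \<le> (e * (\<Sum>p\<in>A. c p))\<^sup>2" if "u \<in> space \<sigma>" for u
    proof (rule abs_le_square_iff[THEN iffD1])
      have u: "norm u = 1" using that by (simp add: space_eq)
      have "\<bar>X u - (\<Sum>l<?K. b l * h l u)\<bar> = \<bar>\<Sum>p\<in>A. c p * (\<bar>n p \<bullet> u\<bar> - poly g (n p \<bullet> u))\<bar>"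
        unfolding gh X_def by (simp add: right_diff_distrib sum_subtractf)
      also have "\<dots> \<le> (\<Sum>p\<in>A. \<bar>c p * (\<bar>n p \<bullet> u\<bar> - poly g (n p \<bullet> u))\<bar>)"
        by (rule sum_abs)
      also have "\<dots> \<le> (\<Sum>p\<in>A. e * c p)"
      proof (rule sum_mono)
        fix p assume p: "p \<in> A"
        have "\<bar>\<bar>n p \<bullet> u\<bar> - poly g (n p \<bullet> u)\<bar> \<le> e"
        proof -
          have "n p \<bullet> u \<in> {-1..1}"
            using abs_inner_le_1[OF n[OF p] u] by (simp add: abs_le_iff)
          then show ?thesis
            using g[of "n p \<bullet> u"] by simp
        qed
        from mult_left_mono[OF this c[OF p]]
        show "\<bar>c p * (\<bar>n p \<bullet> u\<bar> - poly g (n p \<bullet> u))\<bar> \<le> e * c p"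
          using c[OF p] by (simp add: abs_mult mult.commute)
      qed
      also have "\<dots> \<le> \<bar>e * (\<Sum>p\<in>A. c p)\<bar>"
        by (simp add: sum_distrib_left)
      finally show "\<bar>X u - (\<Sum>l<?K. b l * h l u)\<bar> \<le> \<bar>e * (\<Sum>p\<in>A. c p)\<bar>" .
    qed
    then have "(\<integral>u. (X u - (\<Sum>l<?K. b l * h l u))\<^sup>2 \<partial>\<sigma>) \<le> (\<integral>u. (e * (\<Sum>p\<in>A. c p))\<^sup>2 \<partial>\<sigma>)"
      by (intro integral_mono ci)
    then have "(\<integral>u. (X u - (\<Sum>l<?K. b l * h l u))\<^sup>2 \<partial>\<sigma>) \<le> (e * (\<Sum>p\<in>A. c p))\<^sup>2"
      by (simp only: lebesgue_integral_const prob_space scaleR_one)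
    moreover have "(\<Sum>l<?K. Q l / ?d l * (b l - ?d l * ?a l)\<^sup>2) \<ge> 0"
      using Q d by (intro sum_nonneg mult_nonneg_nonneg divide_nonneg_pos) auto
    ultimately have "?V - ?S ?K \<le> (e * (\<Sum>p\<in>A. c p))\<^sup>2"
      unfolding dist by linarith
    then show ?thesis by blast
  qed
  have "?S \<longlonglongrightarrow> ?V"
  proof (rule LIMSEQ_I)
    fix r :: real assume r: "r > 0"
    define s where "s = (\<Sum>p\<in>A. c p)"
    have s: "s \<ge> 0" unfolding s_def using c by (rule sum_nonneg)
    \<comment> \<open>Adding 1 keeps the quotient meaningful when the total weight is zero, for
      instance for empty \<open>A\<close>.\<close>
    define e where "e = sqrt r / (s + 1)"
    have e: "e > 0" using r s by (simp add: e_def)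
    have "e * s < sqrt r"
      using r s by (simp add: e_def field_simps)
    then have "(e * s)\<^sup>2 < r"
      using e s r by (metis mult_nonneg_nonneg less_imp_le real_sqrt_pow2 power_strict_mono zero_less_numeral)
    then obtain K where K: "?V - ?S K < r"
      using lower[OF e] unfolding s_def by (meson le_less_trans)
    have "norm (?S K' - ?V) < r" if "K' \<ge> K" for K'
    proof -
      \<comment> \<open>All terms are nonnegative, so one partial sum close to the limit controls
        all later ones.\<close>
      have "?S K \<le> ?S K'"
        using that Q d by (intro sum_mono2) (auto intro!: mult_nonneg_nonneg)
      then show ?thesis using upper[of K'] K by simp
    qed
    then show "\<exists>K. \<forall>K'\<ge>K. norm (?S K' - ?V) < r" by blast
  qed
  then show "(\<lambda>l. ?d l * (?a l)\<^sup>2 * Q l) sums (\<integral>u. (\<Sum>p\<in>A. c p * \<bar>n p \<bullet> u\<bar>)\<^sup>2 \<partial>\<sigma>)"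
    by (simp add: sums_def X_def)
qed

lemma integral_abs_inner:
  assumes "norm x = 1"
  shows "(\<integral>u. \<bar>x \<bullet> u\<bar> \<partial>\<sigma>) = abs_legendre_coeff 0"
  using integral_abs_legendre[OF assms assms, of 0] by (simp add: legendre_0)

text \<open>In Parseval's series the term of degree 0 is the squared mean, so removing it leaves the
  variance; the odd degrees vanish and the even ones are reindexed.\<close>

lemma cosine_transform_variance:
  fixes n :: "nat \<Rightarrow> real^3" and c :: "nat \<Rightarrow> real"
  assumes n: "\<And>p. p \<in> A \<Longrightarrow> norm (n p) = 1" and c: "\<And>p. p \<in> A \<Longrightarrow> c p \<ge> 0" and A: "finite A"
  shows "((\<lambda>j. (abs_legendre_coeff (2 * j))\<^sup>2 *
      (real (2 * (2 * j) + 1) * (\<Sum>p\<in>A. \<Sum>q\<in>A. c p * c q * poly (legendre (2 * j)) (n p \<bullet> n q))))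
    has_sum variance (\<lambda>u. \<Sum>p\<in>A. c p * \<bar>n p \<bullet> u\<bar>)) {1..}"
proof -
  let ?Q = "\<lambda>l. \<Sum>p\<in>A. \<Sum>q\<in>A. c p * c q * poly (legendre l) (n p \<bullet> n q)"
  define X where "X u = (\<Sum>p\<in>A. c p * \<bar>n p \<bullet> u\<bar>)" for u
  define T where "T l = (2 * real l + 1) * (abs_legendre_coeff l)\<^sup>2 * ?Q l" for l
  have T: "T sums (\<integral>u. (X u)\<^sup>2 \<partial>\<sigma>)" and Q: "?Q l \<ge> 0" for l
    unfolding T_def X_def using cosine_transform_parseval[OF n c A] by auto
  \<comment> \<open>Nonnegativity turns the ordered series into an unconditional sum, from which
    index sets can be removed and reindexed.\<close>
  have "T l \<ge> 0" for l
    unfolding T_def using Q by (intro mult_nonneg_nonneg) auto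
  with T have "(T has_sum (\<integral>u. (X u)\<^sup>2 \<partial>\<sigma>)) UNIV"
    by (intro sums_nonneg_imp_has_sum)
  then have "(T has_sum (\<integral>u. (X u)\<^sup>2 \<partial>\<sigma>) - (\<Sum>l\<in>{0}. T l)) (UNIV - {0})"
    by (intro has_sum_Diff has_sum_finite) auto
  moreover have T0: "T 0 = (expectation X)\<^sup>2"
  proof -
    have "expectation X = (\<Sum>p\<in>A. c p * abs_legendre_coeff 0)"
      unfolding X_def using n
      by (subst Bochner_Integration.integral_sum)
         (auto intro!: integrable_continuous_on_sphere continuous_intros simp: integral_abs_inner)
    then have "expectation X = (\<Sum>p\<in>A. c p) * abs_legendre_coeff 0"
      by (simp only: sum_distrib_right)
    then show ?thesis
      by (simp add: T_def legendre_0 power2_eq_square sum_product mult_ac)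
  qed
  moreover have "variance X = (\<integral>u. (X u)\<^sup>2 \<partial>\<sigma>) - (expectation X)\<^sup>2"
    by (rule variance_eq) (auto intro!: integrable_continuous_on_sphere continuous_intros simp: X_def)
  ultimately have "(T has_sum variance X) (UNIV - {0})"
    by simp
  also have "(T has_sum variance X) (UNIV - {0}) \<longleftrightarrow> (T has_sum variance X) ((\<lambda>j. 2 * j) ` {1..})"
  proof (rule has_sum_cong_neutral)
    fix l :: nat assume "l \<in> (UNIV - {0}) - (\<lambda>j. 2 * j) ` {1..}"
    then have "odd l"
      by (auto elim!: evenE simp: image_iff)
    then show "T l = 0"
      by (simp add: T_def abs_legendre_coeff_odd)
  qed auto
  also have "\<dots> \<longleftrightarrow> ((T \<circ> (\<lambda>j. 2 * j)) has_sum variance X) {1..}"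
    by (rule has_sum_reindex) (auto simp: inj_on_def)
  finally show ?thesis
    unfolding X_def o_def T_def by (simp add: mult_ac add_ac)
qed

end

section \<open>The degree-two part and tight frames\<close>

text \<open>The inner product of nested vectors is the Frobenius inner product, so pairing rank-one
  matrices reduces to products of inner products, and pairing with \<open>mat 1\<close> takes the
  trace.\<close>

lemma inner_outer_product: "outer_product u v \<bullet> outer_product x y = (u \<bullet> x) * (v \<bullet> y)"
  unfolding inner_vec_def sum_product by (simp add: outer_product_def inner_vec_def mult_ac)

lemma inner_outer_product_mat: "outer_product u v \<bullet> mat 1 = u \<bullet> v" for u v :: "real^'n"
  by (simp add: outer_product_def inner_vec_def mat_def if_distrib[where f = "\<lambda>x. _ * x"] cong: if_cong)

lemma inner_outer_product_vec: "x \<bullet> (outer_product u u *v x) = (u \<bullet> x)\<^sup>2"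
  by (simp add: outer_product_def inner_vec_def matrix_vector_mult_def power2_eq_square
    sum_distrib_left sum_distrib_right mult_ac)

text \<open>Polarisation: the quadratic form of the difference at sums of two basis vectors recovers
  each entry, by symmetry.\<close>

lemma symmetric_matrix_eqI:
  fixes M M' :: "real^'n^'n"
  assumes sym: "transpose M = M" "transpose M' = M'" and eq: "\<And>x. x \<bullet> (M *v x) = x \<bullet> (M' *v x)"
  shows "M = M'"
proof -
  define B where "B = M - M'"
  have B: "x \<bullet> (B *v x) = 0" for x
    by (simp add: B_def eq matrix_vector_mult_diff_rdistrib inner_diff_right)
  have symB: "B $ i $ j = B $ j $ i" for i j
    using sym by (simp add: B_def transpose_def vec_eq_iff)
  have entry: "axis i 1 \<bullet> (B *v axis j 1) = B $ i $ j" for i j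
    by (simp add: inner_axis' matrix_vector_mult_basis column_def)
  have "B $ i $ j = 0" for i j
    using B[of "axis i 1 + axis j 1"] B[of "axis i 1"] B[of "axis j 1"] symB[of i j]
    by (simp add: matrix_vector_right_distrib inner_add_left inner_add_right entry)
  then show ?thesis
    by (simp add: B_def vec_eq_iff)
qed

theorem propositionC1:
  fixes N :: nat and n :: "nat \<Rightarrow> real^3" and c :: "nat \<Rightarrow> real"
    and \<sigma> \<mu> :: "(real^3) measure" and Y :: "nat \<Rightarrow> int \<Rightarrow> real^3 \<Rightarrow> complex"
    and \<Omega> :: "'w measure" and U :: "'w \<Rightarrow> real^3"
    and M :: "real^3^3" and s :: real
  assumes N: "N \<ge> 1"
    and n: "\<And>p. p \<in> {1..N} \<Longrightarrow> n p \<in> sphere 0 1"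
    and c: "\<And>p. p \<in> {1..N} \<Longrightarrow> c p > 0"
    and \<mu>: "\<mu> = symmetrized_measure N c n"
    and M: "M = (\<Sum>p=1..N. c p *\<^sub>R outer_product (n p) (n p))"
    and s: "s = (\<Sum>p=1..N. c p)"
    and \<sigma>: "uniform_sphere_measure \<sigma>"
    and Y: "orthonormal_spherical_harmonics \<sigma> Y"
    and \<Omega>: "prob_space \<Omega>"
    and U: "U \<in> measurable \<Omega> \<sigma>" "distr \<Omega> \<sigma> U = \<sigma>"
  shows "(\<forall>l. even l \<longrightarrow>
           (\<Sum>m=- int l..int l. (cmod (harmonic_coeff Y \<mu> l m))\<^sup>2) =
             real (2 * l + 1) *
             (\<Sum>p=1..N. \<Sum>q=1..N. c p * c q * poly (legendre l) (n p \<bullet> n q))) \<and>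
         (\<Sum>p=1..N. \<Sum>q=1..N. c p * c q * poly (legendre 2) (n p \<bullet> n q)) =
           1 / 2 * (3 * (frobenius_norm M)\<^sup>2 - s\<^sup>2) \<and>
         1 / 2 * (3 * (frobenius_norm M)\<^sup>2 - s\<^sup>2) =
           3 / 2 * (frobenius_norm (M - (s / 3) *\<^sub>R mat 1))\<^sup>2 \<and>
         ((\<lambda>j. (abs_legendre_coeff (2 * j))\<^sup>2 *
             (\<Sum>m=- int (2 * j)..int (2 * j). (cmod (harmonic_coeff Y \<mu> (2 * j) m))\<^sup>2))
           has_sum prob_space.variance \<Omega> (\<lambda>\<omega>. \<integral>x. \<bar>U \<omega> \<bullet> x\<bar> \<partial>\<mu>)) {1..} \<and>
         (abs_legendre_coeff 2)\<^sup>2 * (\<Sum>m=-2..2. (cmod (harmonic_coeff Y \<mu> 2 m))\<^sup>2) =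
           15 / 128 * (frobenius_norm (M - (s / 3) *\<^sub>R mat 1))\<^sup>2 \<and>
         ((abs_legendre_coeff 2)\<^sup>2 * (\<Sum>m=-2..2. (cmod (harmonic_coeff Y \<mu> 2 m))\<^sup>2) = 0 \<longleftrightarrow>
           weighted_unit_norm_tight_frame N c n) \<and>
         (weighted_unit_norm_tight_frame N c n \<longleftrightarrow> M = (s / 3) *\<^sub>R mat 1)"
proof -
  interpret S: uniform_sphere \<sigma>
    using \<sigma> by unfold_locales
  interpret \<Omega>: prob_space \<Omega> by fact
  have n1: "norm (n p) = 1" if "p \<in> {1..N}" for p
    using n[OF that] by simp
  have nn: "n p \<bullet> n p = 1" if "p \<in> {1..N}" for p
    using n1[OF that] by (simp add: norm_eq_1)
  let ?Q = "\<lambda>l. \<Sum>p=1..N. \<Sum>q=1..N. c p * c q * poly (legendre l) (n p \<bullet> n q)"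
  let ?I = "(s / 3) *\<^sub>R mat 1 :: real^3^3"
  have coeff: "(\<Sum>m=- int l..int l. (cmod (harmonic_coeff Y \<mu> l m))\<^sup>2) = real (2 * l + 1) * ?Q l" if l: "even l" for l
  proof -
    \<comment> \<open>In even degree a harmonic takes equal values at antipodes, so the two half
      masses at each pair combine.\<close>
    have "harmonic_coeff Y \<mu> l m = (\<Sum>p=1..N. of_real (c p) * cnj (Y l m (n p)))" if m: "m \<in> {- int l..int l}" for m
    proof -
      have sh: "spherical_harmonic l (Y l m)"
        using Y m by (simp add: orthonormal_spherical_harmonics_def)
      have "(\<lambda>x. cnj (Y l m x)) \<in> borel_measurable sphere_borel"
        unfolding sphere_borel_def
        by (intro borel_measurable_continuous_on_restrict continuous_intros continuous_on_spherical_harmonic[OF sh])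
      then have "harmonic_coeff Y \<mu> l m = (\<Sum>p=1..N. (c p / 2) *\<^sub>R (cnj (Y l m (n p)) + cnj (Y l m (- n p))))"
        unfolding harmonic_coeff_def \<mu> by (intro integral_symmetrized_measure n c)
      also have "\<dots> = (\<Sum>p=1..N. of_real (c p) * cnj (Y l m (n p)))"
        by (intro sum.cong refl)
           (simp add: spherical_harmonic_uminus[OF sh n1] l scaleR_conv_of_real)
      finally show ?thesis .
    qed
    then have "of_real (\<Sum>m=- int l..int l. (cmod (harmonic_coeff Y \<mu> l m))\<^sup>2) =
        (\<Sum>m=- int l..int l. (\<Sum>p=1..N. of_real (c p) * cnj (Y l m (n p))) * cnj (\<Sum>p=1..N. of_real (c p) * cnj (Y l m (n p))))"
      unfolding of_real_sum complex_norm_square by simp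
    also have "\<dots> = (\<Sum>m=- int l..int l. \<Sum>p=1..N. \<Sum>q=1..N. of_real (c p * c q) * (Y l m (n q) * cnj (Y l m (n p))))"
      unfolding cnj_sum sum_product by (simp add: mult_ac)
    \<comment> \<open>The sum over \<open>m\<close> is moved inside to match the addition
      theorem.\<close>
    also have "\<dots> = (\<Sum>p=1..N. \<Sum>q=1..N. of_real (c p * c q) * (\<Sum>m=- int l..int l. Y l m (n q) * cnj (Y l m (n p))))"
      unfolding sum_distrib_left
      by (subst sum.swap, rule sum.cong[OF refl], subst sum.swap, rule refl)
    also have "\<dots> = (\<Sum>p=1..N. \<Sum>q=1..N. of_real (c p * c q) * of_real (real (2 * l + 1) * poly (legendre l) (n p \<bullet> n q)))"
      using n1 by (intro sum.cong refl arg_cong2[where f = "(*)"])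
        (subst S.addition_theorem[OF Y], auto simp: inner_commute)
    also have "\<dots> = of_real (real (2 * l + 1) * ?Q l)"
      by (simp add: sum_distrib_left mult_ac)
    finally show ?thesis
      by (simp only: of_real_eq_iff)
  qed
  have comm: "n q \<bullet> n p = n p \<bullet> n q" for p q
    by (rule inner_commute)
  have MM: "(norm M)\<^sup>2 = (\<Sum>p=1..N. \<Sum>q=1..N. c p * c q * (n p \<bullet> n q)\<^sup>2)"
    unfolding power2_norm_eq_inner M
    by (simp add: inner_sum_left inner_sum_right inner_outer_product power2_eq_square sum_distrib_left comm mult_ac)
  have ss: "s\<^sup>2 = (\<Sum>p=1..N. \<Sum>q=1..N. c p * c q)"
    by (simp add: s power2_eq_square sum_product)
  have Q2: "?Q 2 = 1 / 2 * (3 * (norm M)\<^sup>2 - s\<^sup>2)"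
    unfolding MM ss
    by (simp add: poly_legendre_2 sum_distrib_left field_simps sum_subtractf flip: sum_divide_distrib)
  have MI: "M \<bullet> mat 1 = s"
    unfolding M s by (simp add: inner_sum_left inner_outer_product_mat nn)
  have II: "mat 1 \<bullet> (mat 1 :: real^3^3) = 3"
    by (simp add: inner_vec_def mat_def sum_3)
  \<comment> \<open>Subtracting the multiple of the identity with the same trace lowers the squared
    norm by a third of the squared trace; here the traces \<open>M \<bullet> mat 1 = s\<close> and
    \<open>mat 1 \<bullet> mat 1 = 3\<close> enter.\<close>
  have dev: "1 / 2 * (3 * (norm M)\<^sup>2 - s\<^sup>2) = 3 / 2 * (norm (M - ?I))\<^sup>2"
    unfolding power2_norm_eq_inner using MI II
    by (simp add: inner_diff_left inner_diff_right inner_commute[of "mat 1" M] power2_eq_square field_simps)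
  \<comment> \<open>The constant is \<open>(1/8)^2 * 5 * (3/2)\<close>: squared cosine coefficient,
    number of harmonics, and the factor from \<open>dev\<close>.\<close>
  have deg2: "(abs_legendre_coeff 2)\<^sup>2 * (\<Sum>m=-2..2. (cmod (harmonic_coeff Y \<mu> 2 m))\<^sup>2) = 15 / 128 * (norm (M - ?I))\<^sup>2"
    using coeff[of 2] unfolding Q2 dev by (simp add: abs_legendre_coeff_2 power2_eq_square)
  have var: "((\<lambda>j. (abs_legendre_coeff (2 * j))\<^sup>2 *
        (\<Sum>m=- int (2 * j)..int (2 * j). (cmod (harmonic_coeff Y \<mu> (2 * j) m))\<^sup>2))
      has_sum \<Omega>.variance (\<lambda>\<omega>. \<integral>x. \<bar>U \<omega> \<bullet> x\<bar> \<partial>\<mu>)) {1..}"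
  proof -
    define X where "X u = (\<Sum>p=1..N. c p * \<bar>n p \<bullet> u\<bar>)" for u
    have X: "(\<integral>x. \<bar>u \<bullet> x\<bar> \<partial>\<mu>) = X u" for u
    proof -
      have "(\<lambda>x. \<bar>u \<bullet> x\<bar>) \<in> borel_measurable sphere_borel"
        unfolding sphere_borel_def
        by (intro borel_measurable_continuous_on_restrict continuous_intros)
      then have "(\<integral>x. \<bar>u \<bullet> x\<bar> \<partial>\<mu>) = (\<Sum>p=1..N. (c p / 2) *\<^sub>R (\<bar>u \<bullet> n p\<bar> + \<bar>u \<bullet> - n p\<bar>))"
        unfolding \<mu> by (intro integral_symmetrized_measure n c)
      then show ?thesis
        by (simp add: X_def inner_commute)
    qed
    have cX: "continuous_on (sphere 0 1) (\<lambda>u. f (X u))" if "continuous_on UNIV f" for f :: "real \<Rightarrow> real"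
      unfolding X_def by (intro continuous_on_compose2[OF that] continuous_intros) auto
    \<comment> \<open>Expectations transfer through the law of \<open>U\<close>. Two instances are
      used: the identity for the mean, and the squared deviation for the variance.\<close>
    have tr: "\<Omega>.expectation (\<lambda>\<omega>. f (X (U \<omega>))) = S.expectation (\<lambda>u. f (X u))" if "continuous_on UNIV f" for f :: "real \<Rightarrow> real"
      using integral_distr[OF U(1) S.borel_measurable_continuous_on_sphere[OF cX[OF that]]] U(2) by simp
    have "\<Omega>.variance (\<lambda>\<omega>. X (U \<omega>)) = S.variance X"
      using tr[of "\<lambda>x. x"] tr[of "\<lambda>x. (x - S.expectation X)\<^sup>2"] by (simp add: continuous_intros)
    moreover have "((\<lambda>j. (abs_legendre_coeff (2 * j))\<^sup>2 * (real (2 * (2 * j) + 1) * ?Q (2 * j))) has_sum S.variance X) {1..}"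
      unfolding X_def using n1 c by (intro S.cosine_transform_variance) (auto simp: less_imp_le)
    moreover have "(\<Sum>m=- int (2 * j)..int (2 * j). (cmod (harmonic_coeff Y \<mu> (2 * j) m))\<^sup>2) =
        real (2 * (2 * j) + 1) * ?Q (2 * j)" for j
      by (rule coeff) simp
    ultimately show ?thesis
      unfolding X by (simp only:)
  qed
  have frame: "weighted_unit_norm_tight_frame N c n \<longleftrightarrow> M = ?I"
  proof -
    \<comment> \<open>The frame sum is the quadratic form of \<open>M\<close>, so tightness says
      that this form is a multiple of the squared norm.\<close>
    have Mx: "(\<Sum>p=1..N. c p * (n p \<bullet> x)\<^sup>2) = x \<bullet> (M *v x)" for x
    proof -
      have "M *v x = (\<Sum>p=1..N. c p *\<^sub>R (outer_product (n p) (n p) *v x))"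
        unfolding M by (induction N) (simp_all add: matrix_vector_mult_add_rdistrib scaleR_matrix_vector_assoc)
      then show ?thesis
        by (simp add: inner_sum_right inner_outer_product_vec)
    qed
    have Ix: "x \<bullet> ((A *\<^sub>R mat 1) *v x) = A * (norm x)\<^sup>2" for A and x :: "real^3"
      by (simp add: scaleR_matrix_vector_assoc [symmetric] power2_norm_eq_inner)
    have symM: "transpose M = M"
      by (simp add: M transpose_def vec_eq_iff outer_product_def mult_ac)
    \<comment> \<open>At least one positive weight is present, so \<open>s / 3\<close> qualifies as
      a positive frame bound.\<close>
    have s0: "s > 0"
      unfolding s using N c by (intro sum_pos) auto
    show ?thesis
    proof
      assume "weighted_unit_norm_tight_frame N c n"
      then obtain A where A: "x \<bullet> (M *v x) = A * (norm x)\<^sup>2" for x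
        unfolding weighted_unit_norm_tight_frame_def Mx by blast
      have "transpose (A *\<^sub>R mat 1 :: real^3^3) = A *\<^sub>R mat 1"
        by (simp add: transpose_def vec_eq_iff mat_def)
      with symM have MA: "M = A *\<^sub>R mat 1"
        by (rule symmetric_matrix_eqI) (simp only: A Ix)
      \<comment> \<open>Taking traces determines the frame bound: \<open>3 * A = s\<close>.\<close>
      then show "M = ?I"
        using MI II by simp
    next
      assume "M = ?I"
      then show "weighted_unit_norm_tight_frame N c n"
        unfolding weighted_unit_norm_tight_frame_def Mx using s0 n1 by (auto simp: Ix intro!: exI[of _ "s / 3"])
    qed
  qed
  have "(abs_legendre_coeff 2)\<^sup>2 * (\<Sum>m=-2..2. (cmod (harmonic_coeff Y \<mu> 2 m))\<^sup>2) = 0 \<longleftrightarrow>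
      weighted_unit_norm_tight_frame N c n"
    unfolding deg2 frame by simp
  then show ?thesis
    using coeff Q2 dev var deg2 frame by blast
qed

end
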